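(* For every integer $i\ge 0$ there is $d_0=d_0(i)$ such that for all $d\ge d_0$, the Hamming ball $H_d^i$ maximises the largest eigenvalue among all subgraphs of $Q_d$ with the same number of vertices as $H_d^i$; that is, $\lambda_1(G)\le \lambda_1(H_d^i)$ for every subgraph $G$ of $Q_d$ with $|V(G)|=|V(H_d^i)|$.
   Context: $Q_d$ is the $d$-dimensional hypercube with vertex set the subsets of $[d]=\{1,\dots,d\}$, two vertices adjacent iff their symmetric difference has size one. The Hamming ball $H_d^i$ is the subgraph of $Q_d$ induced by all subsets of $[d]$ of size at most $i$. $\lambda_1(G)$ denotes the largest eigenvalue of the adjacency matrix of $G$. *)

theory Defs
  imports
    "Graph_Theory.Digraph_Component"
    "Jordan_Normal_Form.Char_Poly"
begin

text \<open>
  A finite simple graph is a symmetric, loop-free digraph without parallel arcs (locale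
  \<open>graph\<close>): an edge $uv$ is the pair of arcs $(u,v)$, $(v,u)$.
\<close>

definition hypercube :: "nat \<Rightarrow> (nat set, nat set \<times> nat set) pre_digraph" where
  "hypercube d = with_proj
     \<lparr> pverts = Pow {1..d},
       parcs = {(A, B). A \<subseteq> {1..d} \<and> B \<subseteq> {1..d} \<and> card (sym_diff A B) = 1} \<rparr>"

definition hamming_ball :: "nat \<Rightarrow> nat \<Rightarrow> (nat set, nat set \<times> nat set) pre_digraph" where
  "hamming_ball d i = hypercube d \<restriction> {A. A \<subseteq> {1..d} \<and> card A \<le> i}"

text \<open>The list \<open>vs\<close> fixes the order in which the vertices index the rows and columns.\<close>

definition adjacency_mat :: "('a, 'b) pre_digraph \<Rightarrow> 'a list \<Rightarrow> real mat" where
  "adjacency_mat G vs =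
     mat (length vs) (length vs) (\<lambda>(j, k). if vs ! j \<rightarrow>\<^bsub>G\<^esub> vs ! k then 1 else 0)"

text \<open>
  The enumeration is immaterial by \<open>eigenvalue_adjacency_mat_cong\<close> below. For a finite
  graph with at least one vertex the matrix is real symmetric, so the set of its real eigenvalues is
  finite and nonempty.
\<close>

definition lambda1 :: "('a, 'b) pre_digraph \<Rightarrow> real" where
  "lambda1 G = Max {k. eigenvalue
     (adjacency_mat G (SOME vs. distinct vs \<and> set vs = verts G)) k}"

lemma adjacency_mat_mult:
  assumes "distinct vs" "j < length vs"
  shows "(adjacency_mat G vs *\<^sub>v vec (length vs) (\<lambda>k. f (vs ! k))) $ j =
    (\<Sum>v \<in> set vs. if vs ! j \<rightarrow>\<^bsub>G\<^esub> v then f v else 0)"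
proof -
  have "(adjacency_mat G vs *\<^sub>v vec (length vs) (\<lambda>k. f (vs ! k))) $ j =
      (\<Sum>k = 0..<length vs. if vs ! j \<rightarrow>\<^bsub>G\<^esub> vs ! k then f (vs ! k) else 0)"
    using assms(2) unfolding adjacency_mat_def
    by (auto simp: scalar_prod_def intro!: sum.cong)
  also have "\<dots> = (\<Sum>v \<in> set vs. if vs ! j \<rightarrow>\<^bsub>G\<^esub> v then f v else 0)"
    using assms(1)
    by (intro sum.reindex_bij_betw bij_betw_nth) auto
  finally show ?thesis .
qed

lemma eigenvalue_adjacency_mat_iff:
  assumes "distinct vs"
  shows "eigenvalue (adjacency_mat G vs) k \<longleftrightarrow>
    (\<exists>f. (\<exists>v \<in> set vs. f v \<noteq> 0) \<and>
      (\<forall>u \<in> set vs. (\<Sum>v \<in> set vs. if u \<rightarrow>\<^bsub>G\<^esub> v then f v else 0) = k * f u))"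
    (is "?L \<longleftrightarrow> ?R")
proof
  have [simp]: "dim_row (adjacency_mat G vs) = length vs"
    by (simp add: adjacency_mat_def)
  show ?R if ?L
  proof -
    from that obtain x where x: "x \<in> carrier_vec (length vs)" "x \<noteq> 0\<^sub>v (length vs)"
      "adjacency_mat G vs *\<^sub>v x = k \<cdot>\<^sub>v x"
      by (auto simp: eigenvalue_def eigenvector_def)
    define f where "f v = x $ (the_inv_into {..<length vs} ((!) vs) v)" for v
    have inj: "inj_on ((!) vs) {..<length vs}"
      using assms by (simp add: inj_on_nth)
    have f: "f (vs ! j) = x $ j" if "j < length vs" for j
      using that by (simp add: f_def the_inv_into_f_f[OF inj])
    have x_eq: "x = vec (length vs) (\<lambda>j. f (vs ! j))"
      using x(1) f by (intro eq_vecI) auto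
    have "\<exists>j < length vs. x $ j \<noteq> 0"
      using x(1,2) by (metis carrier_vecD eq_vecI index_zero_vec)
    then have "\<exists>v \<in> set vs. f v \<noteq> 0"
      using f nth_mem by metis
    moreover have "(\<Sum>v \<in> set vs. if u \<rightarrow>\<^bsub>G\<^esub> v then f v else 0) = k * f u"
      if u: "u \<in> set vs" for u
    proof -
      from u obtain j where j: "j < length vs" "u = vs ! j" by (metis in_set_conv_nth)
      have "(adjacency_mat G vs *\<^sub>v x) $ j = k * x $ j"
        using x(1,3) j(1) by (metis carrier_vecD index_smult_vec(1))
      then show ?thesis
        unfolding adjacency_mat_mult[OF assms j(1), of G f, folded x_eq]
        by (simp only: j(2) f[OF j(1)])
    qed
    ultimately show ?thesis by blast
  qed
  show ?L if ?R
  proof -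
    from that obtain f where f: "\<exists>v \<in> set vs. f v \<noteq> 0"
      "\<And>u. u \<in> set vs \<Longrightarrow>
        (\<Sum>v \<in> set vs. if u \<rightarrow>\<^bsub>G\<^esub> v then f v else 0) = k * f u" by blast
    let ?x = "vec (length vs) (\<lambda>j. f (vs ! j))"
    obtain j where "j < length vs" "f (vs ! j) \<noteq> 0"
      using f(1) by (metis in_set_conv_nth)
    then have "?x \<noteq> 0\<^sub>v (length vs)"
      by (metis index_vec index_zero_vec(1))
    moreover have "adjacency_mat G vs *\<^sub>v ?x = k \<cdot>\<^sub>v ?x"
    proof (rule eq_vecI)
      fix j assume "j < dim_vec (k \<cdot>\<^sub>v ?x)"
      then have j: "j < length vs" by simp
      have "(adjacency_mat G vs *\<^sub>v ?x) $ j = k * f (vs ! j)"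
        using adjacency_mat_mult[OF assms j, of G f] f(2)[of "vs ! j"] j by (metis nth_mem)
      then show "(adjacency_mat G vs *\<^sub>v ?x) $ j = (k \<cdot>\<^sub>v ?x) $ j"
        using j by (metis dim_vec index_smult_vec(1) index_vec)
    qed simp
    ultimately show ?thesis
      unfolding eigenvalue_def eigenvector_def by (intro exI[of _ ?x]) auto
  qed
qed

lemma eigenvalue_adjacency_mat_cong:
  assumes "distinct vs" "distinct ws" "set vs = set ws"
  shows "eigenvalue (adjacency_mat G vs) k \<longleftrightarrow> eigenvalue (adjacency_mat G ws) k"
  using assms by (simp add: eigenvalue_adjacency_mat_iff)

lemma graph_hypercube: "graph (hypercube d)"
proof -
  have "finite {(A, B). A \<subseteq> {1..d} \<and> B \<subseteq> {1..d} \<and> card (sym_diff A B) = 1}"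
    by (rule finite_subset[of _ "Pow {1..d} \<times> Pow {1..d}"]) auto
  moreover have "sym {(A, B). A \<subseteq> {1..d} \<and> B \<subseteq> {1..d} \<and> card (sym_diff A B) = 1}"
    by (rule symI) (simp add: Un_commute)
  ultimately show ?thesis
    unfolding hypercube_def
    by unfold_locales
      (auto simp: arc_to_ends_def symmetric_def)
qed

lemma induced_subgraph_hamming_ball: "induced_subgraph (hamming_ball d i) (hypercube d)"
proof -
  interpret graph "hypercube d" by (rule graph_hypercube)
  show ?thesis
    unfolding hamming_ball_def
    by (rule induced_induce) (auto simp: hypercube_def)
qed

lemma verts_hamming_ball: "verts (hamming_ball d i) = {A. A \<subseteq> {1..d} \<and> card A \<le> i}"
  by (simp add: hamming_ball_def)

end

(*
Compressing a Perron vector along the reflections A -> A symdiff {j} and the swaps of two elements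
replaces G by a down-set F that is closed under left shifts, has the same number of vertices, and
has an eigenvalue theta >= lambda1 G with a nonnegative eigenfunction x. Let H be the ball, mu its
largest eigenvalue and y its eigenfunction. Summing x_u y_v over all adjacent pairs in two ways gives

  (theta - mu) <x, y> = (sum over u in F - H of x_u (A y)_u) - (sum over v in H - F of y_v (A x)_v),

so it suffices that the second sum dominates. If theta >= mu, then theta is at least about c sqrt d,
where c is the largest root of the Hermite polynomial of degree i + 1, and x_u is at most about
d^(-|u|/2) x_{} up to a small power of d. As |F - H| = |H - F|, the terms of the first sum, which live
on levels i and i + 1, are then smaller by almost a factor d than those of the second.

The bound on x_u comes from the maximum principle with an explicit supersolution. Split the ground set
into S = {1..t}, with t = o(d) a power of d, and two intervals L1, L2 of proportions alpha and 1 - alpha.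
Since |F| = |H|, left shifts forbid sets with more than i elements outside S, and sets that meet S, miss
L1 and have i elements in L2. The Hermite values h_k solve the limiting equation on levels 0..i with
equality; removing the empty set, or the forbidden corner for sets that meet S, leaves a gap that
absorbs the edges in the directions of S.
*)

theory Submission
  imports Defs "HOL-Analysis.Analysis" "HOL-Real_Asymp.Real_Asymp"
begin

section \<open>Nonnegative eigenfunctions and the largest eigenvalue\<close>

text \<open>The obstacle is that compression still allows sets of size about log d, and that the
  Hermite values solve the limiting equation with equality at the very value c that the eigenvalue
  approaches after division by sqrt d. A supersolution therefore has to win a constant: a rate c' <
  c. Each element of \<open>S\<close> multiplies its weight by beta, so that relative to sqrt d the
  deletions in \<open>S\<close> contribute O((log d) / beta) and the insertions t beta / d. With
  beta = d^eta and t about d^(1 - 2 eta) both vanish. A small t conflicts with the counting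
  argument, which needs t^(i+1) to exceed d^i by a power of d; eta = 1/(8(i+1)) gives (1 - 2
  eta)(i+1) = i + 3/4. The price is a factor d^(eta |u|) in the decay, harmless because the final
  exponent of d is 4 i eta - 1 < -1/2. The proportion alpha = 1 - 1/(4i) makes alpha^i at least 3/4,
  so that twice the number of i-subsets of the first alpha d elements exceeds |F|, while 1 - alpha
  stays positive, so that forbidding the corner removes a term of positive weight.\<close>

definition nbsum :: "'a set \<Rightarrow> ('a \<Rightarrow> 'a \<Rightarrow> bool) \<Rightarrow> ('a \<Rightarrow> real) \<Rightarrow> 'a \<Rightarrow> real" where
  "nbsum V E x u = (\<Sum>v\<in>V. if E u v then x v else 0)"

lemma nbsum_mono:
  assumes "\<And>v. v \<in> V \<Longrightarrow> E u v \<Longrightarrow> x v \<le> y v"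
  shows "nbsum V E x u \<le> nbsum V E y u"
  unfolding nbsum_def using assms by (intro sum_mono) auto

lemma nbsum_add: "nbsum V E (\<lambda>v. x v + y v) u = nbsum V E x u + nbsum V E y u"
  unfolding nbsum_def unfolding sum.distrib[symmetric] by (intro sum.cong) auto

lemma nbsum_scale: "nbsum V E (\<lambda>v. k * x v) u = k * nbsum V E x u"
  unfolding nbsum_def sum_distrib_left by (intro sum.cong) auto

lemma nbsum_symmetric:
  assumes "symp E"
  shows "(\<Sum>u\<in>V. x u * nbsum V E y u) = (\<Sum>u\<in>V. y u * nbsum V E x u)"
proof -
  have "(\<Sum>u\<in>V. x u * nbsum V E y u) = (\<Sum>u\<in>V. \<Sum>v\<in>V. if E u v then x u * y v else 0)"
    unfolding nbsum_def sum_distrib_left by (intro sum.cong) auto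
  also have "\<dots> = (\<Sum>v\<in>V. \<Sum>u\<in>V. if E u v then x u * y v else 0)" by (rule sum.swap)
  also have "\<dots> = (\<Sum>v\<in>V. y v * nbsum V E x v)"
    unfolding nbsum_def sum_distrib_left using assms by (intro sum.cong) (auto dest: sympD)
  finally show ?thesis .
qed

lemma Rayleigh_max_exists:
  fixes V :: "'a set" and E :: "'a \<Rightarrow> 'a \<Rightarrow> bool"
  assumes "finite V" "V \<noteq> {}"
  obtains x k where "(\<Sum>v\<in>V. (x v)\<^sup>2) = 1" "(\<Sum>u\<in>V. x u * nbsum V E x u) = k"
    "\<And>y. (\<Sum>u\<in>V. y u * nbsum V E y u) \<le> k * (\<Sum>v\<in>V. (y v)\<^sup>2)"
proof -
  define B where "B = {x :: 'a \<Rightarrow> real. \<forall>v. x v \<in> (if v \<in> V then {-1..1} else {0})}"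
  define q where "q x = (\<Sum>u\<in>V. x u * nbsum V E x u)" for x
  define n where "n x = (\<Sum>v\<in>V. (x v)\<^sup>2)" for x :: "'a \<Rightarrow> real"
  \<comment> \<open>\<open>B\<close> is the product of [-1, 1] over \<open>V\<close> and {0}
    elsewhere, so Tychonoff gives compactness although \<open>'a\<close> may be infinite; the zero
    values off \<open>V\<close> cost nothing, since the form reads only \<open>V\<close>.\<close>
  have "compactin (product_topology (\<lambda>_. euclideanreal) UNIV)
      (PiE UNIV (\<lambda>v. if v \<in> V then {-1..1} else {0::real}))"
    by (subst compactin_PiE) auto
  moreover have "PiE UNIV (\<lambda>v. if v \<in> V then {-1..1} else {0::real}) = B"
    unfolding B_def by (auto simp: PiE_def Pi_def)
  ultimately have B: "compact B" by (simp add: euclidean_product_topology)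
  have cn: "continuous_on UNIV n"
    unfolding n_def by (intro continuous_intros continuous_on_product_coordinates)
  have cq: "continuous_on UNIV q"
  proof -
    have "q = (\<lambda>x. \<Sum>u\<in>V. \<Sum>v\<in>V. (if E u v then 1 else 0) * (x u * x v))"
      unfolding q_def nbsum_def sum_distrib_left by (intro ext sum.cong) auto
    then show ?thesis
      by (simp only:) (intro continuous_intros continuous_on_product_coordinates)
  qed
  have "closed {x. n x = 1}"
    using cn by (intro closed_Collect_eq) auto
  then have K: "compact (B \<inter> {x. n x = 1})"
    using B by (simp add: compact_Int_closed)
  obtain v0 where v0: "v0 \<in> V" using assms by auto
  have "(\<lambda>v. if v = v0 then 1 else 0) \<in> B \<inter> {x. n x = 1}"
  proof -
    have "n (\<lambda>v. if v = v0 then 1 else 0) = (\<Sum>v\<in>V. if v = v0 then 1 else 0)"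
      unfolding n_def by (intro sum.cong) auto
    then show ?thesis using v0 assms unfolding B_def by (auto simp: n_def)
  qed
  then have ne: "B \<inter> {x. n x = 1} \<noteq> {}" by blast
  obtain x where x: "x \<in> B" "n x = 1" and mx: "\<And>y. y \<in> B \<Longrightarrow> n y = 1 \<Longrightarrow> q y \<le> q x"
    using continuous_attains_sup[OF K ne, of q] continuous_on_subset[OF cq] by auto
  have "q y \<le> q x * n y" for y
  proof (cases "n y = 0")
    case True
    then have "y v = 0" if "v \<in> V" for v
      using that assms unfolding n_def by (simp add: sum_nonneg_eq_0_iff)
    then have "q y = 0" unfolding q_def by simp
    then show ?thesis using True by simp
  next
    case False
    then have pos: "n y > 0" unfolding n_def by (simp add: sum_nonneg order_le_neq_trans)
    define s where "s = sqrt (n y)"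
    have s: "s > 0" "s\<^sup>2 = n y" using pos by (auto simp: s_def)
    define z where "z v = (if v \<in> V then (1/s) * y v else 0)" for v
    have nz: "n z = 1"
    proof -
      have "n z = (\<Sum>v\<in>V. (1/s)\<^sup>2 * (y v)\<^sup>2)"
        unfolding n_def z_def by (intro sum.cong) (auto simp: power_mult_distrib power_divide)
      also have "\<dots> = (1/s)\<^sup>2 * n y" unfolding n_def sum_distrib_left ..
      finally show ?thesis using s pos by (simp add: power_divide)
    qed
    have "z v \<in> (if v \<in> V then {-1..1} else {0})" for v
    proof (cases "v \<in> V")
      case True
      have "(z v)\<^sup>2 \<le> n z" unfolding n_def using True assms(1)
        by (intro member_le_sum) auto
      then have "\<bar>z v\<bar> \<le> 1" using nz by (simp add: abs_square_le_1)
      then show ?thesis using True by auto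
    qed (simp add: z_def)
    then have "q z \<le> q x" using nz by (intro mx) (auto simp: B_def)
    have "nbsum V E z u = (1/s) * nbsum V E y u" for u
      unfolding nbsum_scale[symmetric] unfolding nbsum_def by (intro sum.cong) (auto simp: z_def)
    then have "q z = (\<Sum>u\<in>V. (1/s)\<^sup>2 * (y u * nbsum V E y u))"
      unfolding q_def by (intro sum.cong) (auto simp: z_def power2_eq_square)
    then have "q z = q y / n y"
      unfolding sum_distrib_left[symmetric] s(2)[symmetric] q_def by (simp add: power_divide)
    then show ?thesis using \<open>q z \<le> q x\<close> pos by (simp add: pos_divide_le_eq)
  qed
  then show thesis using that[of x "q x"] x(2) unfolding q_def n_def by auto
qed

text \<open>Absolute values do not lower the form, so the maximiser can be taken nonnegative, and
  the eigenvalue equation is the first-order condition at a maximum. The graph may be disconnected,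
  so \<open>x\<close> may have zeros.\<close>

lemma Perron_nonneg_eigenfunction:
  fixes V :: "'a set" and E :: "'a \<Rightarrow> 'a \<Rightarrow> bool"
  assumes "finite V" "V \<noteq> {}" "symp E" "\<And>v. \<not> E v v"
  obtains x k where "\<And>v. 0 \<le> x v" "\<exists>v\<in>V. x v \<noteq> 0" "\<And>u. u \<in> V \<Longrightarrow> nbsum V E x u = k * x u"
    "\<And>y. (\<Sum>u\<in>V. y u * nbsum V E y u) \<le> k * (\<Sum>v\<in>V. (y v)\<^sup>2)"
proof -
  obtain x0 k where x0: "(\<Sum>v\<in>V. (x0 v)\<^sup>2) = 1" "(\<Sum>u\<in>V. x0 u * nbsum V E x0 u) = k"
    and k: "\<And>y. (\<Sum>u\<in>V. y u * nbsum V E y u) \<le> k * (\<Sum>v\<in>V. (y v)\<^sup>2)"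
    using Rayleigh_max_exists[OF assms(1,2), of E] by metis
  define x where "x v = \<bar>x0 v\<bar>" for v
  have n: "(\<Sum>v\<in>V. (x v)\<^sup>2) = 1" using x0 by (simp add: x_def)
  have "k \<le> (\<Sum>u\<in>V. x u * nbsum V E x u)"
    unfolding x0(2)[symmetric] nbsum_def sum_distrib_left
    by (intro sum_mono) (auto simp: x_def abs_mult[symmetric])
  then have q: "(\<Sum>u\<in>V. x u * nbsum V E x u) = k" using k[of x] n by simp
  have eig: "nbsum V E x w = k * x w" if w: "w \<in> V" for w
  proof -
    define a where "a = nbsum V E x w - k * x w"
    define \<delta> where "\<delta> v = (if v = w then 1 else 0 :: real)" for v
    \<comment> \<open>Moving the value at \<open>w\<close> by \<open>e\<close> changes the form by
      \<open>2 * e * nbsum V E x w\<close> only, since \<open>w\<close> is not its own neighbour,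
      and the squared norm by \<open>2 * e * x w + e^2\<close>. A linear term bounded by a quadratic
      one for all \<open>e\<close> forces \<open>a = 0\<close>.\<close>
    have b: "2 * a * e \<le> k * e\<^sup>2" for e :: real
    proof -
      have 1: "(\<Sum>v\<in>V. (x v + e * \<delta> v)\<^sup>2) = 1 + 2 * e * x w + e\<^sup>2"
      proof -
        have "(\<Sum>v\<in>V. (x v + e * \<delta> v)\<^sup>2) = (\<Sum>v\<in>V. (x v)\<^sup>2 + (if v = w then 2 * e * x w + e\<^sup>2 else 0))"
          by (intro sum.cong) (auto simp: \<delta>_def power2_eq_square algebra_simps)
        then show ?thesis using w assms(1) n by (simp add: sum.distrib)
      qed
      have d: "(\<Sum>u\<in>V. \<delta> u * f u) = f w" for f
      proof -
        have "(\<Sum>u\<in>V. \<delta> u * f u) = (\<Sum>u\<in>V. if u = w then f u else 0)"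
          by (intro sum.cong) (auto simp: \<delta>_def)
        then show ?thesis using w assms(1) by simp
      qed
      have dd: "nbsum V E \<delta> w = 0"
        unfolding nbsum_def by (intro sum.neutral) (auto simp: \<delta>_def assms(4))
      have dx: "(\<Sum>u\<in>V. x u * nbsum V E \<delta> u) = nbsum V E x w"
        using nbsum_symmetric[OF assms(3), of x V \<delta>] d by simp
      have "(\<Sum>u\<in>V. (x u + e * \<delta> u) * nbsum V E (\<lambda>v. x v + e * \<delta> v) u) =
        (\<Sum>u\<in>V. x u * nbsum V E x u + e * (\<delta> u * nbsum V E x u) + e * (x u * nbsum V E \<delta> u)
           + e\<^sup>2 * (\<delta> u * nbsum V E \<delta> u))"
        unfolding nbsum_add nbsum_scale
        by (intro sum.cong) (auto simp: power2_eq_square algebra_simps)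
      also have "\<dots> = k + 2 * e * nbsum V E x w"
        unfolding sum.distrib sum_distrib_left[symmetric] q d dx dd by simp
      finally show ?thesis using k[of "\<lambda>v. x v + e * \<delta> v"] 1
        by (simp add: a_def algebra_simps)
    qed
    have "a = 0"
    proof (rule ccontr)
      assume "a \<noteq> 0"
      define c where "c = \<bar>k\<bar> + 1"
      have c: "c > 0" "k \<le> c" by (auto simp: c_def)
      have "2 * a * (a / c) \<le> k * (a / c)\<^sup>2" by (rule b)
      also have "\<dots> \<le> c * (a / c)\<^sup>2" using c by (intro mult_right_mono) auto
      also have "\<dots> = a * (a / c)" using c by (simp add: power2_eq_square)
      finally have "a * (a / c) \<le> 0" by linarith
      moreover have "a * a > 0" using \<open>a \<noteq> 0\<close> by (auto simp: zero_less_mult_iff)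
      then have "a * (a / c) > 0" using c by simp
      ultimately show False by simp
    qed
    then show ?thesis by (simp add: a_def)
  qed
  show thesis
  proof (rule that[of x k])
    show "\<exists>v\<in>V. x v \<noteq> 0" 
    proof (rule ccontr)
      assume "\<not> (\<exists>v\<in>V. x v \<noteq> 0)"
      then have "(\<Sum>v\<in>V. (x v)\<^sup>2) = 0" by simp
      then show False using n by simp
    qed
  qed (auto simp: eig k x_def)
qed

text \<open>\<open>lambda1\<close> is a \<open>Max\<close>, so the real eigenvalues must be known to
  be finitely many; they are roots of the characteristic polynomial. The Rayleigh maximum is itself
  an eigenvalue and bounds all others.\<close>

lemma lambda1_is_Rayleigh_max:
  assumes "graph G" "verts G \<noteq> {}"
  obtains x where "\<And>v. 0 \<le> x v" "\<exists>v\<in>verts G. x v \<noteq> 0"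
    "\<And>u. u \<in> verts G \<Longrightarrow> nbsum (verts G) (\<lambda>u v. u \<rightarrow>\<^bsub>G\<^esub> v) x u = lambda1 G * x u"
    "\<And>y. (\<Sum>u\<in>verts G. y u * nbsum (verts G) (\<lambda>u v. u \<rightarrow>\<^bsub>G\<^esub> v) y u)
       \<le> lambda1 G * (\<Sum>v\<in>verts G. (y v)\<^sup>2)"
proof -
  interpret graph G by fact
  let ?E = "\<lambda>u v. u \<rightarrow>\<^bsub>G\<^esub> v"
  have sy: "symp ?E" using sym_arcs unfolding symmetric_def by (intro sympI) (rule symD)
  have irr: "\<not> ?E v v" for v
    using adj_not_same by blast
  obtain x k where x: "\<And>v. 0 \<le> x v" "\<exists>v\<in>verts G. x v \<noteq> 0"
    "\<And>u. u \<in> verts G \<Longrightarrow> nbsum (verts G) ?E x u = k * x u"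
    and k: "\<And>y. (\<Sum>u\<in>verts G. y u * nbsum (verts G) ?E y u) \<le> k * (\<Sum>v\<in>verts G. (y v)\<^sup>2)"
    by (rule Perron_nonneg_eigenfunction[OF finite_verts assms(2) sy irr]) (rule that; assumption)
  define vs where "vs = (SOME vs. distinct vs \<and> set vs = verts G)"
  have "\<exists>vs. distinct vs \<and> set vs = verts G"
    using finite_distinct_list[OF finite_verts] by blast
  then have vs: "distinct vs" "set vs = verts G"
    unfolding vs_def by (metis (mono_tags, lifting) someI_ex)+
  let ?A = "adjacency_mat G vs"
  have iff: "eigenvalue ?A l \<longleftrightarrow>
    (\<exists>f. (\<exists>v \<in> verts G. f v \<noteq> 0) \<and> (\<forall>u \<in> verts G. nbsum (verts G) ?E f u = l * f u))" for l
    using eigenvalue_adjacency_mat_iff[OF vs(1), of G l] unfolding vs(2) nbsum_def .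
  have A: "?A \<in> carrier_mat (length vs) (length vs)" unfolding adjacency_mat_def by simp
  have "char_poly ?A \<noteq> 0" using degree_monic_char_poly[OF A] by auto
  then have fin: "finite {l. eigenvalue ?A l}"
    unfolding eigenvalue_root_char_poly[OF A] by (rule poly_roots_finite)
  have "l \<le> k" if l: "eigenvalue ?A l" for l
  proof -
    obtain f where f: "\<exists>v \<in> verts G. f v \<noteq> 0" "\<forall>u \<in> verts G. nbsum (verts G) ?E f u = l * f u"
      using l iff by blast
    have "(\<Sum>u\<in>verts G. f u * nbsum (verts G) ?E f u) = l * (\<Sum>v\<in>verts G. (f v)\<^sup>2)"
      using f(2) unfolding sum_distrib_left by (intro sum.cong) (auto simp: power2_eq_square)
    moreover have "(\<Sum>v\<in>verts G. (f v)\<^sup>2) > 0"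
      using f(1) finite_verts by (auto intro: sum_pos2)
    ultimately show ?thesis using k[of f] by simp
  qed
  moreover have "eigenvalue ?A k" using iff x by blast
  ultimately have "lambda1 G = k"
    unfolding lambda1_def vs_def[symmetric] using fin by (intro Max_eqI) auto
  then show thesis using that[of x] x k by auto
qed

section \<open>Compression in the cube\<close>

text \<open>Two-point symmetrisation. \<open>P\<close> is the half that is to receive the larger
  values, its mirror image gets the smaller ones, and vertices in neither half are fixed. By
  \<open>no_crossing\<close> an edge between the halves can only join a vertex to its own mirror
  image; any other would pair a maximum with a minimum.\<close>

locale polarization =
  fixes V :: "'a set" and E :: "'a \<Rightarrow> 'a \<Rightarrow> bool" and \<sigma> :: "'a \<Rightarrow> 'a" and P :: "'a set"
  assumes finite_V: "finite V"
    and closed: "u \<in> V \<Longrightarrow> \<sigma> u \<in> V"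
    and involution: "u \<in> V \<Longrightarrow> \<sigma> (\<sigma> u) = u"
    and automorphism: "u \<in> V \<Longrightarrow> v \<in> V \<Longrightarrow> E (\<sigma> u) (\<sigma> v) \<longleftrightarrow> E u v"
    and subset: "P \<subseteq> V"
    and disjoint: "u \<in> P \<Longrightarrow> \<sigma> u \<notin> P"
    and fixed: "u \<in> V \<Longrightarrow> u \<notin> P \<Longrightarrow> \<sigma> u \<notin> P \<Longrightarrow> \<sigma> u = u"
    and no_crossing: "u \<in> P \<Longrightarrow> v \<in> P \<Longrightarrow> E u (\<sigma> v) \<Longrightarrow> u = v"
begin

definition polar :: "('a \<Rightarrow> real) \<Rightarrow> 'a \<Rightarrow> real" where
  "polar x u = (if u \<in> P then max (x u) (x (\<sigma> u))
     else if \<sigma> u \<in> P then min (x u) (x (\<sigma> u)) else x u)"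

text \<open>Companion of \<open>polar\<close> on supports: a member leaves the mirror half only if
  its image in \<open>P\<close> is free, so the cardinality of the family is kept.\<close>

definition move :: "'a set \<Rightarrow> 'a \<Rightarrow> 'a" where
  "move F u = (if u \<notin> P \<and> \<sigma> u \<in> P \<and> \<sigma> u \<notin> F then \<sigma> u else u)"

lemma sum_reflect: "(\<Sum>u\<in>V. f (\<sigma> u)) = (\<Sum>u\<in>V. f u)"
  by (rule sum.reindex_bij_witness[of _ \<sigma> \<sigma>]) (auto simp: closed involution)

lemma sum_le_of_pairs:
  fixes f g :: "'a \<Rightarrow> real"
  assumes "\<And>u. u \<in> V \<Longrightarrow> f u + f (\<sigma> u) \<le> g u + g (\<sigma> u)"
  shows "sum f V \<le> sum g V"
proof -
  have "2 * sum f V = (\<Sum>u\<in>V. f u + f (\<sigma> u))" by (simp add: sum.distrib sum_reflect)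
  also have "\<dots> \<le> (\<Sum>u\<in>V. g u + g (\<sigma> u))" using assms by (intro sum_mono)
  also have "\<dots> = 2 * sum g V" by (simp add: sum.distrib sum_reflect)
  finally show ?thesis by simp
qed

lemma polar_pair:
  assumes "u \<in> V"
  shows "(polar x u = x u \<and> polar x (\<sigma> u) = x (\<sigma> u)) \<or> (polar x u = x (\<sigma> u) \<and> polar x (\<sigma> u) = x u)"
  using assms involution[OF assms] disjoint fixed unfolding polar_def
  by (auto simp: max_def min_def) 

lemma polar_norm: "(\<Sum>u\<in>V. (polar x u)\<^sup>2) = (\<Sum>u\<in>V. (x u)\<^sup>2)"
proof -
  have "(polar x u)\<^sup>2 + (polar x (\<sigma> u))\<^sup>2 = (x u)\<^sup>2 + (x (\<sigma> u))\<^sup>2" if "u \<in> V" for u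
    using polar_pair[OF that, of x] by auto
  then show ?thesis by (intro antisym sum_le_of_pairs) auto
qed

lemma rearrangement:
  fixes a b c d :: real
  shows "a * c + b * d \<le> max a b * max c d + min a b * min c d"
proof -
  have "0 \<le> (a - b) * (c - d)" if "(a \<le> b \<and> c \<le> d) \<or> (b \<le> a \<and> d \<le> c)"
    using that by (auto simp: zero_le_mult_iff)
  moreover have "(a - b) * (c - d) \<le> 0" if "(a \<le> b \<and> d \<le> c) \<or> (b \<le> a \<and> c \<le> d)"
    using that by (auto simp: mult_le_0_iff)
  ultimately show ?thesis by (auto simp: max_def min_def algebra_simps)
qed

text \<open>Three situations. If \<open>u\<close> and \<open>v\<close> lie in the same half, this is
  the rearrangement inequality for two pairs. If they lie in opposite halves, they are mirror images
  and the products do not change. If one endpoint is fixed, its value factors out and the sum over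
  the other pair is unchanged.\<close>

lemma polar_product:
  assumes "u \<in> V" "v \<in> V" "E u v"
  shows "x u * x v + x (\<sigma> u) * x (\<sigma> v) \<le> polar x u * polar x v + polar x (\<sigma> u) * polar x (\<sigma> v)"
proof -
  note inv = involution[OF assms(1)] involution[OF assms(2)]
  consider "u \<in> P" "v \<in> P" | "\<sigma> u \<in> P" "\<sigma> v \<in> P" | "u \<in> P" "\<sigma> v \<in> P" | "\<sigma> u \<in> P" "v \<in> P"
    | "\<sigma> u = u" "u \<notin> P" | "\<sigma> v = v" "v \<notin> P"
    using assms fixed by blast
  then show ?thesis
  proof cases
    case 1
    then show ?thesis using rearrangement[of "x u" "x v" "x (\<sigma> u)" "x (\<sigma> v)"] disjoint
      by (auto simp: polar_def inv max.commute min.commute)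
  next
    case 2
    then show ?thesis using rearrangement[of "x u" "x v" "x (\<sigma> u)" "x (\<sigma> v)"] disjoint[of "\<sigma> u"] disjoint[of "\<sigma> v"]
      by (auto simp: polar_def inv max.commute min.commute)
  next
    case 3
    then have "u = \<sigma> v" using no_crossing[of u "\<sigma> v"] assms inv by auto
    then show ?thesis using polar_pair[OF assms(1), of x] inv by (auto simp: mult.commute)
  next
    case 4
    then have "\<sigma> u = v" using no_crossing[of "\<sigma> u" v] assms inv automorphism[of "\<sigma> u" v] closed
        automorphism[of u "v"] by metis
    then show ?thesis using polar_pair[OF assms(1), of x] inv by (auto simp: mult.commute)
  next
    case 5
    then have "polar x u = x u" by (simp add: polar_def)
    then show ?thesis using polar_pair[OF assms(2), of x] 5 by (auto simp: algebra_simps)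
  next
    case 6
    then have "polar x v = x v" by (simp add: polar_def)
    then show ?thesis using polar_pair[OF assms(1), of x] 6 by (auto simp: algebra_simps)
  qed
qed

lemma polar_form:
  "(\<Sum>u\<in>V. x u * nbsum V E x u) \<le> (\<Sum>u\<in>V. polar x u * nbsum V E (polar x) u)"
proof -
  define f where "f y u v = (if E u v then y u * y v else 0)" for y :: "'a \<Rightarrow> real" and u v
  have eq: "(\<Sum>u\<in>V. y u * nbsum V E y u) = (\<Sum>u\<in>V. \<Sum>v\<in>V. f y u v)" for y
    unfolding nbsum_def sum_distrib_left f_def by (intro sum.cong) auto
  show ?thesis unfolding eq
  proof (rule sum_le_of_pairs)
    fix u assume u: "u \<in> V"
    have *: "(\<Sum>v\<in>V. f y u v) + (\<Sum>v\<in>V. f y (\<sigma> u) v) = (\<Sum>v\<in>V. f y u v + f y (\<sigma> u) (\<sigma> v))" for y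
      unfolding sum.distrib sum_reflect ..
    show "(\<Sum>v\<in>V. f x u v) + (\<Sum>v\<in>V. f x (\<sigma> u) v)
      \<le> (\<Sum>v\<in>V. f (polar x) u v) + (\<Sum>v\<in>V. f (polar x) (\<sigma> u) v)"
      unfolding * using polar_product[OF u, of _ x] automorphism[OF u]
      by (intro sum_mono) (auto simp: f_def)
  qed
qed

lemma polar_nonneg: "(\<And>u. 0 \<le> x u) \<Longrightarrow> 0 \<le> polar x u"
  by (auto simp: polar_def le_max_iff_disj)

lemma inj_on_move:
  assumes "F \<subseteq> V" shows "inj_on (move F) F"
proof (rule inj_onI)
  fix u v assume uv: "u \<in> F" "v \<in> F" "move F u = move F v"
  then have "\<sigma> (\<sigma> u) = u" "\<sigma> (\<sigma> v) = v" using assms involution by auto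
  then show "u = v" using uv unfolding move_def by (metis (full_types))
qed

lemma move_subset: "F \<subseteq> V \<Longrightarrow> move F ` F \<subseteq> V"
  by (auto simp: move_def closed)

text \<open>A vertex of the mirror half gets the minimum, which vanishes for nonnegative
  \<open>x\<close> unless both vertices of the pair belong to \<open>F\<close>; that is precisely
  when \<open>move F\<close> leaves a member there.\<close>

lemma polar_support:
  assumes "F \<subseteq> V" "\<And>u. u \<notin> F \<Longrightarrow> x u = 0" "\<And>u. 0 \<le> x u" "u \<in> V" "u \<notin> move F ` F"
  shows "polar x u = 0"
proof -
  have inv: "\<sigma> (\<sigma> u) = u" using assms involution by blast
  have 1: "u \<notin> F" if "u \<in> P \<or> \<sigma> u \<notin> P \<or> \<sigma> u \<in> F"
    using assms(5) that by (auto simp: move_def image_iff)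
  have 2: "\<sigma> u \<notin> F" if "u \<in> P" "u \<notin> F"
  proof
    assume "\<sigma> u \<in> F"
    moreover have "move F (\<sigma> u) = u" using that disjoint inv by (auto simp: move_def)
    ultimately show False using assms(5) by (metis imageI)
  qed
  have m: "min a b = 0" if "a = 0 \<or> b = 0" "0 \<le> a" "0 \<le> b" for a b :: real
    using that by auto
  show ?thesis
    using 1 2 assms(2)[of u] assms(2)[of "\<sigma> u"] assms(3)[of u] assms(3)[of "\<sigma> u"] m
    by (auto simp: polar_def)
qed

end

section \<open>Flips and swaps of coordinates in the cube\<close>

definition cube_adj :: "'a set \<Rightarrow> 'a set \<Rightarrow> bool" where
  "cube_adj u v \<longleftrightarrow> card (sym_diff u v) = 1"

lemma symp_cube_adj: "symp cube_adj"
  unfolding cube_adj_def by (rule sympI) (simp add: Un_commute)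

lemma cube_adj_irrefl: "\<not> cube_adj u u"
  by (simp add: cube_adj_def)

text \<open>Larger values go to the sets without \<open>j\<close>. An edge across the halves changes
  membership of \<open>j\<close>, hence nothing else.\<close>

lemma polarization_flip:
  assumes "j \<in> X" "finite X"
  shows "polarization (Pow X) cube_adj (\<lambda>u. sym_diff u {j}) {u \<in> Pow X. j \<notin> u}"
proof
  fix u v :: "'a set"
  have "sym_diff (sym_diff u {j}) (sym_diff v {j}) = sym_diff u v" by auto
  then show "cube_adj (sym_diff u {j}) (sym_diff v {j}) \<longleftrightarrow> cube_adj u v" by (simp add: cube_adj_def)
  show "u = v" if asm: "u \<in> {u \<in> Pow X. j \<notin> u}" "v \<in> {u \<in> Pow X. j \<notin> u}" "cube_adj u (sym_diff v {j})"
  proof -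
    obtain a where a: "sym_diff u (sym_diff v {j}) = {a}"
      using asm(3) unfolding cube_adj_def by (meson card_1_singletonE)
    then have "a = j" using asm by blast
    then show ?thesis using asm a by blast
  qed
qed (use assms in auto)

definition swap_elem :: "'a \<Rightarrow> 'a \<Rightarrow> 'a set \<Rightarrow> 'a set" where
  "swap_elem k l u = Transposition.transpose k l ` u"

lemma swap_elem_eq:
  assumes "l \<in> u" "k \<notin> u"
  shows "swap_elem k l u = insert k (u - {l})"
  unfolding swap_elem_def using assms by (auto simp: Transposition.transpose_def image_iff split: if_splits)

text \<open>Larger values go to the sets that contain \<open>k\<close> but not \<open>l\<close>.
  Between the halves, membership of both \<open>k\<close> and \<open>l\<close> changes, so no edge
  of the cube crosses at all.\<close>

lemma polarization_swap:
  assumes "k \<in> X" "l \<in> X" "k \<noteq> l" "finite X"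
  shows "polarization (Pow X) cube_adj (swap_elem k l) {u \<in> Pow X. k \<in> u \<and> l \<notin> u}"
proof
  fix u v :: "'a set"
  let ?t = "Transposition.transpose k l"
  show "swap_elem k l u \<in> Pow X" if "u \<in> Pow X"
    using that assms unfolding swap_elem_def by (auto simp: Transposition.transpose_def)
  show "swap_elem k l (swap_elem k l u) = u"
    unfolding swap_elem_def by (simp add: image_image)
  have "sym_diff (?t ` u) (?t ` v) = ?t ` sym_diff u v"
    by (simp add: image_set_diff image_Un)
  then show "cube_adj (swap_elem k l u) (swap_elem k l v) \<longleftrightarrow> cube_adj u v"
    unfolding cube_adj_def swap_elem_def by (simp add: card_image)
  have mem: "k \<in> swap_elem k l w \<longleftrightarrow> l \<in> w" "l \<in> swap_elem k l w \<longleftrightarrow> k \<in> w" for w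
    unfolding swap_elem_def by (auto simp: Transposition.transpose_def image_iff)
  show "swap_elem k l u \<notin> {u \<in> Pow X. k \<in> u \<and> l \<notin> u}" if "u \<in> {u \<in> Pow X. k \<in> u \<and> l \<notin> u}"
    using that by (auto simp: mem)
  show "swap_elem k l u = u"
    if "u \<in> Pow X" "u \<notin> {u \<in> Pow X. k \<in> u \<and> l \<notin> u}" "swap_elem k l u \<notin> {u \<in> Pow X. k \<in> u \<and> l \<notin> u}"
  proof -
    have "swap_elem k l u \<in> Pow X" using that(1) assms unfolding swap_elem_def by (auto simp: Transposition.transpose_def)
    then have "k \<in> u \<longleftrightarrow> l \<in> u" using that by (auto simp: mem)
    then show ?thesis unfolding swap_elem_def by (auto simp: Transposition.transpose_def image_iff)
  qed
  show "u = v" if asm: "u \<in> {u \<in> Pow X. k \<in> u \<and> l \<notin> u}" "v \<in> {u \<in> Pow X. k \<in> u \<and> l \<notin> u}"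
    "cube_adj u (swap_elem k l v)"
  proof -
    obtain a where a: "sym_diff u (swap_elem k l v) = {a}"
      using asm(3) unfolding cube_adj_def by (meson card_1_singletonE)
    have "k \<in> sym_diff u (swap_elem k l v)" "l \<in> sym_diff u (swap_elem k l v)"
      using asm mem by auto
    then have "k = a" "l = a" unfolding a by auto
    then show ?thesis using assms(3) by simp
  qed
qed (use assms in auto)

definition compressed :: "nat set set \<Rightarrow> bool" where
  "compressed F \<longleftrightarrow> (\<forall>u\<in>F. \<forall>j\<in>u. u - {j} \<in> F) \<and>
     (\<forall>u\<in>F. \<forall>l\<in>u. \<forall>k. 1 \<le> k \<and> k < l \<and> k \<notin> u \<longrightarrow> insert k (u - {l}) \<in> F)"

text \<open>Instead of iterating compressions and proving termination, a pair of family and function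
  with the required properties is chosen for which \<open>wt\<close> is least; any compression that
  moved a member would yield a pair with smaller \<open>wt\<close>.\<close>

lemma compression:
  assumes "F0 \<subseteq> Pow {1..d}" "\<And>u. 0 \<le> x0 u" "\<And>u. u \<notin> F0 \<Longrightarrow> x0 u = 0"
  shows "\<exists>F x. F \<subseteq> Pow {1..d} \<and> card F = card F0 \<and> compressed F \<and>
    (\<forall>u. 0 \<le> x u) \<and> (\<forall>u. u \<notin> F \<longrightarrow> x u = 0) \<and>
    (\<Sum>u\<in>Pow {1..d}. (x u)\<^sup>2) = (\<Sum>u\<in>Pow {1..d}. (x0 u)\<^sup>2) \<and>
    (\<Sum>u\<in>Pow {1..d}. x0 u * nbsum (Pow {1..d}) cube_adj x0 u)
      \<le> (\<Sum>u\<in>Pow {1..d}. x u * nbsum (Pow {1..d}) cube_adj x u)"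
proof -
  let ?V = "Pow {1..d} :: nat set set"
  let ?q = "\<lambda>x. \<Sum>u\<in>?V. x u * nbsum ?V cube_adj x u"
  define good where "good = (\<lambda>(F, x). F \<subseteq> ?V \<and> card F = card F0 \<and> (\<forall>u. 0 \<le> x u) \<and>
    (\<forall>u. u \<notin> F \<longrightarrow> x u = 0) \<and> (\<Sum>u\<in>?V. (x u)\<^sup>2) = (\<Sum>u\<in>?V. (x0 u)\<^sup>2) \<and> ?q x0 \<le> ?q x)"
  define wt where "wt = (\<lambda>(F :: nat set set, x :: nat set \<Rightarrow> real). \<Sum>u\<in>F. \<Sum>u)"
  have "good (F0, x0)" using assms by (auto simp: good_def)
  then obtain p where p: "good p" "\<And>p'. good p' \<Longrightarrow> wt p \<le> wt p'"
    using ex_has_least_nat[of good "(F0, x0)" wt] by blast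
  obtain F x where Fx: "p = (F, x)" by (cases p)
  have F: "F \<subseteq> ?V" "card F = card F0" "\<And>u. 0 \<le> x u" "\<And>u. u \<notin> F \<Longrightarrow> x u = 0"
    "(\<Sum>u\<in>?V. (x u)\<^sup>2) = (\<Sum>u\<in>?V. (x0 u)\<^sup>2)" "?q x0 \<le> ?q x"
    using p(1) unfolding Fx good_def by auto
  have finF: "finite F" using F(1) finite_subset by auto
  have stable: "\<sigma> u \<in> F"
    if pol: "polarization ?V cube_adj \<sigma> P" and less: "\<And>u. u \<in> F \<Longrightarrow> u \<notin> P \<Longrightarrow> \<sigma> u \<in> P \<Longrightarrow> \<Sum>(\<sigma> u) < \<Sum>u"
      and u: "u \<in> F" "u \<notin> P" "\<sigma> u \<in> P" for \<sigma> P u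
  proof (rule ccontr)
    assume n: "\<sigma> u \<notin> F"
    interpret polarization ?V cube_adj \<sigma> P by (rule pol)
    \<comment> \<open>\<open>good\<close> demands zero values everywhere off the family, whereas
      \<open>polar_support\<close> speaks only of subsets of {1..d}; hence the truncation.\<close>
    define x' where "x' v = (if v \<in> ?V then polar x v else 0)" for v
    have q': "?q x' = ?q (polar x)"
      unfolding nbsum_def x'_def by (auto intro!: sum.cong)
    have n': "(\<Sum>u\<in>?V. (x' u)\<^sup>2) = (\<Sum>u\<in>?V. (polar x u)\<^sup>2)"
      unfolding x'_def by (auto intro!: sum.cong)
    have "good (move F ` F, x')"
      unfolding good_def
    proof (clarsimp simp only: prod.case, intro conjI allI impI)
      show "move F ` F \<subseteq> ?V" using move_subset[OF F(1)] .
      show "card (move F ` F) = card F0" using inj_on_move[OF F(1)] F(2) by (simp add: card_image)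
      show "0 \<le> x' v" for v using polar_nonneg F(3) by (simp add: x'_def)
      show "x' v = 0" if "v \<notin> move F ` F" for v
        using polar_support[OF F(1) F(4) F(3), where u = v] that by (auto simp: x'_def)
      show "(\<Sum>u\<in>?V. (x' u)\<^sup>2) = (\<Sum>u\<in>?V. (x0 u)\<^sup>2)" using n' polar_norm F(5) by simp
      show "?q x0 \<le> ?q x'" using q' polar_form[of x] F(6) by simp
    qed
    then have "wt p \<le> wt (move F ` F, x')" by (rule p)
    also have "wt (move F ` F, x') = (\<Sum>u\<in>F. \<Sum>(move F u))"
      using inj_on_move[OF F(1)] by (simp add: wt_def sum.reindex)
    also have "\<dots> < (\<Sum>u\<in>F. \<Sum>u)"
    proof (rule sum_strict_mono_ex1[OF finF])
      show "\<forall>u\<in>F. \<Sum>(move F u) \<le> \<Sum>u" using less by (auto simp: move_def less_imp_le)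
      show "\<exists>u\<in>F. \<Sum>(move F u) < \<Sum>u" using less u n by (auto simp: move_def)
    qed
    finally show False by (simp add: Fx wt_def)
  qed
  have fin: "finite u" if "u \<in> F" for u using that F(1) finite_subset by blast
  have "u - {j} \<in> F" if "u \<in> F" "j \<in> u" for u j
  proof -
    have j: "j \<in> {1..d}" using that F(1) by blast
    have eq: "sym_diff u {j} = u - {j}" if "j \<in> u" for u using that by auto
    have "sym_diff u {j} \<in> F"
    proof (rule stable[OF polarization_flip[OF j]])
      fix v assume v: "v \<in> F" "v \<notin> {u \<in> ?V. j \<notin> u}"
      then have "j \<in> v" using F(1) by auto
      then show "\<Sum>(sym_diff v {j}) < \<Sum>v" using fin[OF v(1)] j sum.remove[of v j "\<lambda>x. x"] by (simp add: eq)
    qed (use that F(1) in auto)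
    then show ?thesis using eq that by simp
  qed
  moreover have "insert k (u - {l}) \<in> F" if "u \<in> F" "l \<in> u" "1 \<le> k" "k < l" "k \<notin> u" for u k l
  proof -
    have "l \<in> {1..d}" using that F(1) by blast
    then have kl: "k \<in> {1..d}" "l \<in> {1..d}" using that by auto
    have "swap_elem k l u \<in> F"
    proof (rule stable[OF polarization_swap[OF kl]])
      fix v assume v: "v \<in> F" "v \<notin> {u \<in> ?V. k \<in> u \<and> l \<notin> u}" "swap_elem k l v \<in> {u \<in> ?V. k \<in> u \<and> l \<notin> u}"
      then have *: "l \<in> v" "k \<notin> v" using that unfolding swap_elem_def
        by (auto simp: Transposition.transpose_def image_iff split: if_splits)
      show "\<Sum>(swap_elem k l v) < \<Sum>v"
        using * fin[OF v(1)] that sum.remove[of v l "\<lambda>x. x"] by (simp add: swap_elem_eq)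
    qed (use that F(1) kl in \<open>auto simp: swap_elem_eq\<close>)
    then show ?thesis using that by (simp add: swap_elem_eq)
  qed
  ultimately have "compressed F" unfolding compressed_def by blast
  then show ?thesis using F by (intro exI[of _ F] exI[of _ x]) blast
qed

text \<open>Every element of \<open>A'\<close> lies below every element of \<open>A\<close>, so
  elements can be exchanged one at a time under any matching; strictness also keeps the new element
  out of \<open>A\<close>.\<close>

lemma compressed_shift:
  assumes "compressed F" "finite A" "card A' = card A" "finite A'" "R \<inter> A = {}" "R \<inter> A' = {}"
    "\<And>a a'. a \<in> A \<Longrightarrow> a' \<in> A' \<Longrightarrow> 1 \<le> a' \<and> a' < a" "R \<union> A \<in> F"
  shows "R \<union> A' \<in> F"
  using assms(2-)
proof (induction "card A" arbitrary: A A' R)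
  case 0
  then show ?case by simp
next
  case (Suc n)
  obtain a where a: "a \<in> A" using Suc by fastforce
  obtain a' where a': "a' \<in> A'" using Suc by fastforce
  have lt: "1 \<le> a'" "a' < a" using Suc.prems a a' by auto
  have "a' \<notin> A" using Suc.prems a' by force
  then have "a' \<notin> R \<union> A" using Suc.prems a' by auto
  then have "insert a' (R \<union> A - {a}) \<in> F"
    using assms(1) Suc.prems a lt unfolding compressed_def by blast
  moreover have "insert a' (R \<union> A - {a}) = insert a' R \<union> (A - {a})" using Suc.prems a by auto
  ultimately have F: "insert a' R \<union> (A - {a}) \<in> F" by simp
  have "insert a' R \<union> (A' - {a'}) \<in> F"
  proof (rule Suc.hyps(1)[of "A - {a}"])
    show "n = card (A - {a})" "card (A' - {a'}) = card (A - {a})"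
      using Suc a a' by auto
    show "insert a' R \<inter> (A - {a}) = {}" "insert a' R \<inter> (A' - {a'}) = {}"
      using Suc.prems \<open>a' \<notin> A\<close> by auto
  qed (use Suc.prems F in auto)
  moreover have "insert a' R \<union> (A' - {a'}) = R \<union> A'" using a' by auto
  ultimately show ?case by simp
qed

lemma compressed_subset:
  assumes "compressed F" "u \<in> F" "v \<subseteq> u" "finite u"
  shows "v \<in> F"
proof -
  have *: "u - B \<in> F" if "finite B" "B \<subseteq> u" for B
    using that
  proof (induction B)
    case empty
    then show ?case using assms(2) by simp
  next
    case (insert b B)
    then have "u - B \<in> F" "b \<in> u - B" by auto
    then have "u - B - {b} \<in> F" using assms(1) unfolding compressed_def by blast
    moreover have "u - B - {b} = u - insert b B" by auto
    ultimately show ?case by simp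
  qed
  have "u - (u - v) \<in> F" using assms(4) by (intro *) auto
  moreover have "u - (u - v) = v" using assms(3) by blast
  ultimately show ?thesis by simp
qed

section \<open>Profiles of supersolutions\<close>

text \<open>Probabilists' Hermite polynomials. Give the sets of size k the value h_k(c) / s^k with s
  = sqrt d. Such a set has k lower and d - k upper neighbours, so for large d the neighbour sum is
  about s / s^k times k h_(k-1)(c) + h_(k+1)(c) = c h_k(c). A root c of h_(i+1) makes level i + 1
  vanish, as it must for the ball.\<close>

fun hermite :: "nat \<Rightarrow> real \<Rightarrow> real" where
  "hermite 0 x = 1"
| "hermite (Suc 0) x = x"
| "hermite (Suc (Suc k)) x = x * hermite (Suc k) x - real (Suc k) * hermite k x"

lemma continuous_on_hermite: "continuous_on A (hermite k)"
proof (induction k rule: induct_nat_012)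
  case (ge2 n)
  have "hermite (Suc (Suc n)) = (\<lambda>x. x * hermite (Suc n) x - real (Suc n) * hermite n x)"
    by auto
  then show ?case using ge2 by (simp only:) (intro continuous_intros)
qed (auto intro: continuous_intros)

lemma hermite_large:
  assumes "real k + 1 \<le> x"
  shows "1 \<le> hermite k x \<and> hermite k x \<le> hermite (Suc k) x"
  using assms
proof (induction k)
  case (Suc k)
  then have IH: "1 \<le> hermite k x" "hermite k x \<le> hermite (Suc k) x" by auto
  have "hermite (Suc k) x \<le> (x - real (Suc k)) * hermite (Suc k) x"
    using Suc.prems IH mult_right_mono[of 1 "x - real (Suc k)" "hermite (Suc k) x"] by simp
  also have "\<dots> \<le> hermite (Suc (Suc k)) x"
    using mult_left_mono[OF IH(2), of "real (Suc k)"] by (simp add: algebra_simps)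
  finally show ?case using IH by simp
qed simp

text \<open>Induction by interlacing: at the largest root c of h_(i+1) the recurrence gives
  h_(i+2)(c) = -(i+1) h_i(c) < 0, while h_(i+2) is positive from i + 3 on. So it has roots beyond c,
  and a largest one by compactness. Positivity of the lower polynomials beyond c is carried
  along.\<close>

lemma hermite_largest_root:
  "\<exists>c\<ge>0. (i > 0 \<longrightarrow> c > 0) \<and> hermite (Suc i) c = 0 \<and> (\<forall>k\<le>i. hermite k c > 0) \<and>
     (\<forall>x>c. \<forall>k\<le>Suc i. hermite k x > 0)"
proof (induction i)
  case 0
  have "hermite k x > 0" if "x > 0" "k \<le> Suc 0" for k x
    using that by (cases k) auto
  then show ?case by (intro exI[of _ 0]) auto
next
  case (Suc i)
  then obtain c where c: "c \<ge> 0" "hermite (Suc i) c = 0" "\<And>k. k \<le> i \<Longrightarrow> hermite k c > 0"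
    "\<And>x k. x > c \<Longrightarrow> k \<le> Suc i \<Longrightarrow> hermite k x > 0" by blast
  let ?f = "hermite (Suc (Suc i))"
  have neg: "?f c < 0" using c(2) c(3)[of i] by simp
  have pos: "?f x > 0" if "x \<ge> real i + 3" for x
    using hermite_large[of "Suc (Suc i)" x] that by simp
  have root: "\<exists>y\<ge>a. ?f y = 0" if "?f a \<le> 0" for a
  proof -
    have "a \<le> real i + 3" using that pos[of a] by linarith
    then show ?thesis
      using IVT'[of ?f a 0 "real i + 3", OF that less_imp_le[OF pos] _ continuous_on_hermite] by auto
  qed
  define R where "R = {x \<in> {c..real i + 3}. ?f x = 0}"
  have R: "R = {c..real i + 3} \<inter> ?f -` {0}" unfolding R_def by auto
  have "closed R" unfolding R
    by (intro continuous_closed_preimage continuous_on_hermite) auto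
  moreover have "bounded R" by (rule bounded_subset[of "{c..real i + 3}"]) (auto simp: R_def)
  ultimately have "compact R" by (simp add: compact_eq_bounded_closed)
  have inR: "y \<in> R" if "?f y = 0" "y \<ge> c" for y
    using that pos[of y] unfolding R_def by force
  then have "R \<noteq> {}" using root[of c] neg by force
  then obtain s where s: "s \<in> R" "\<And>y. y \<in> R \<Longrightarrow> y \<le> s"
    using compact_attains_sup[OF \<open>compact R\<close>] by blast
  have fs: "?f s = 0" using s(1) R_def by auto
  then have sc: "s > c" using s(1) neg unfolding R_def by (cases "s = c") auto
  have gt: "?f x > 0" if "x > s" for x
  proof (rule ccontr)
    assume "\<not> ?f x > 0"
    then obtain y where "y \<ge> x" "?f y = 0" using root[of x] by fastforce
    then show False using s(2)[of y] inR[of y] that sc by simp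
  qed
  have "hermite k x > 0" if "x > s" "k \<le> Suc (Suc i)" for x k
    using that gt[of x] c(4)[of x k] sc by (cases "k = Suc (Suc i)") auto
  then show ?case using fs sc c by (intro exI[of _ s]) auto
qed

section \<open>Strict supersolutions on finite index sets\<close>

lemma finite_pos_lower_bound:
  fixes g :: "'a \<Rightarrow> real"
  assumes "finite A" "\<And>x. x \<in> A \<Longrightarrow> g x > 0"
  shows "\<exists>e>0. \<forall>x\<in>A. e \<le> g x"
proof (intro exI conjI ballI)
  show "Min (insert 1 (g ` A)) > 0" using assms by auto
  show "Min (insert 1 (g ` A)) \<le> g x" if "x \<in> A" for x
    using assms(1) that by (intro Min_le) auto
qed

text \<open>Lowering \<open>W\<close> slightly at the points where the inequality is strict makes it strict at all
  their neighbours as well; the rank function says that this spreads everywhere.\<close>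

lemma strict_supersolution:
  fixes M :: "'a \<Rightarrow> 'a \<Rightarrow> real"
  assumes fin: "finite X" and c: "c > 0" and M: "\<And>x y. x \<in> X \<Longrightarrow> y \<in> X \<Longrightarrow> M x y \<ge> 0"
    and h: "\<And>x. x \<in> X \<Longrightarrow> h x > 0" and super: "\<And>x. x \<in> X \<Longrightarrow> (\<Sum>y\<in>X. M x y * h y) \<le> c * h x"
    and rank: "\<And>x. x \<in> X \<Longrightarrow> (\<Sum>y\<in>X. M x y * h y) < c * h x \<or> (\<exists>y\<in>X. M x y > 0 \<and> r y < (r x :: nat))"
  obtains W c' where "c' < c" "\<And>x. x \<in> X \<Longrightarrow> W x > 0" "\<And>x. x \<in> X \<Longrightarrow> (\<Sum>y\<in>X. M x y * W y) \<le> c' * W x"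
proof -
  \<comment> \<open>The points at which strictness is secured after \<open>n\<close> rounds; by
    \<open>rank\<close>, every point that \<open>A (Suc n)\<close> adds has a neighbour in
    \<open>A n\<close>.\<close>
  define A where "A n = {x \<in> X. r x < n \<or> (\<Sum>y\<in>X. M x y * h y) < c * h x}" for n
  have "\<exists>W. (\<forall>x\<in>X. W x > 0 \<and> (\<Sum>y\<in>X. M x y * W y) \<le> c * W x) \<and>
    (\<forall>x\<in>A n. (\<Sum>y\<in>X. M x y * W y) < c * W x)" for n
  proof (induction n)
    case 0
    then show ?case using h super by (intro exI[of _ h]) (auto simp: A_def)
  next
    case (Suc n)
    then obtain W where W: "\<And>x. x \<in> X \<Longrightarrow> W x > 0" "\<And>x. x \<in> X \<Longrightarrow> (\<Sum>y\<in>X. M x y * W y) \<le> c * W x"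
      and strict: "\<And>x. x \<in> A n \<Longrightarrow> (\<Sum>y\<in>X. M x y * W y) < c * W x" by blast
    have AX: "A n \<subseteq> X" by (auto simp: A_def)
    define g where "g x = (c * W x - (\<Sum>y\<in>X. M x y * W y)) / (c * W x)" for x
    have "g x > 0" if "x \<in> A n" for x
      using strict[OF that] W(1)[of x] AX that c by (auto simp: g_def)
    then obtain e0 where e0: "e0 > 0" "\<And>x. x \<in> A n \<Longrightarrow> e0 \<le> g x"
      using finite_pos_lower_bound[of "A n" g] finite_subset[OF AX fin] by metis
    \<comment> \<open>The factor \<open>1 - e\<close> must stay positive and use up less than the
      relative gap at every point of \<open>A n\<close>.\<close>
    define e where "e = min e0 1 / 2"
    have e: "e > 0" "e < 1" "e < e0" using e0(1) by (auto simp: e_def)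
    define W' where "W' x = (if x \<in> A n then (1 - e) * W x else W x)" for x
    have le: "W' x \<le> W x" if "x \<in> X" for x using W(1)[OF that] e by (simp add: W'_def)
    have sum_le: "(\<Sum>y\<in>X. M x y * W' y) \<le> (\<Sum>y\<in>X. M x y * W y)" if "x \<in> X" for x
      using le M that by (intro sum_mono mult_left_mono) auto
    have W'_pos: "W' x > 0" if "x \<in> X" for x using W(1)[OF that] e by (simp add: W'_def)
    have A': "(\<Sum>y\<in>X. M x y * W' y) < c * W' x" if x: "x \<in> A n" for x
    proof -
      have xX: "x \<in> X" using x AX by auto
      then have p: "c * W x > 0" using W(1) c by simp
      have "e < g x" using e e0(2)[OF x] by simp
      then have "e * (c * W x) < c * W x - (\<Sum>y\<in>X. M x y * W y)"
        using p unfolding g_def by (simp add: pos_less_divide_eq)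
      then show ?thesis using sum_le[OF xX] x by (simp add: W'_def algebra_simps)
    qed
    have all: "(\<Sum>y\<in>X. M x y * W' y) \<le> c * W' x" if "x \<in> X" for x
      using A'[of x] sum_le[OF that] W(2)[OF that] by (cases "x \<in> A n") (auto simp: W'_def)
    have "(\<Sum>y\<in>X. M x y * W' y) < c * W' x" if x: "x \<in> A (Suc n)" "x \<notin> A n" for x
    proof -
      have xX: "x \<in> X" using x by (auto simp: A_def)
      have "\<not> (\<Sum>y\<in>X. M x y * h y) < c * h x" "\<not> r x < n" "r x < Suc n" using x by (auto simp: A_def)
      then obtain y where y: "y \<in> X" "M x y > 0" "r y < n" using rank[OF xX] by auto
      then have yA: "y \<in> A n" by (auto simp: A_def)
      have "M x y * W' y < M x y * W y" using yA y W(1)[OF y(1)] e by (simp add: W'_def)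
      then have "(\<Sum>y\<in>X. M x y * W' y) < (\<Sum>y\<in>X. M x y * W y)"
        using y(1) le M xX by (intro sum_strict_mono_ex1 fin) (auto intro!: mult_left_mono)
      then show ?thesis using W(2)[OF xX] x by (simp add: W'_def)
    qed
    then show ?case using all A' W'_pos by (intro exI[of _ W']) blast
  qed
  note ex = this
  \<comment> \<open>The sum is merely a convenient bound on all ranks, which makes
    \<open>A n\<close> all of \<open>X\<close>.\<close>
  define n where "n = Suc (\<Sum>x\<in>X. r x)"
  have "r x < n" if "x \<in> X" for x
    using member_le_sum[OF that, of r] fin unfolding n_def by simp
  then have An: "A n = X" by (auto simp: A_def)
  obtain W where W: "\<And>x. x \<in> X \<Longrightarrow> W x > 0" "\<And>x. x \<in> X \<Longrightarrow> (\<Sum>y\<in>X. M x y * W y) < c * W x"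
    using ex[of n] unfolding An by blast
  define g where "g x = (c * W x - (\<Sum>y\<in>X. M x y * W y)) / W x" for x
  have "g x > 0" if "x \<in> X" for x using W that by (simp add: g_def)
  then obtain e where e: "e > 0" "\<And>x. x \<in> X \<Longrightarrow> e \<le> g x"
    using finite_pos_lower_bound[OF fin, of g] by metis
  show thesis
  proof (rule that[of "c - e" W])
    show "(\<Sum>y\<in>X. M x y * W y) \<le> (c - e) * W x" if "x \<in> X" for x
      using e(2)[OF that] W(1)[OF that] unfolding g_def by (simp add: pos_le_divide_eq algebra_simps)
  qed (use e W in auto)
qed

lemma hermite_rec: "real k * hermite (k - 1) c + hermite (Suc k) c = c * hermite k c"
  by (cases k) auto

text \<open>The profile for sets disjoint from \<open>S\<close>, indexed by cardinality. Level 0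
  carries no inequality, because {} is the exceptional vertex of the maximum principle. With level 0
  dropped, the Hermite values become strict at level 1, where the term h_0 is missing, and
  strictness spreads upwards along the path.\<close>

lemma path_profile:
  assumes i: "i \<ge> 1" and c: "c > 0" "hermite (Suc i) c = 0" "\<And>k. k \<le> i \<Longrightarrow> hermite k c > 0"
  obtains V c' where "c' < c" "\<And>a. a \<le> i \<Longrightarrow> V a > 0" "\<And>a. a > i \<Longrightarrow> V a = 0"
    "\<And>a. 1 \<le> a \<Longrightarrow> a \<le> i \<Longrightarrow> real a * V (a - 1) + V (Suc a) \<le> c' * V a"
proof -
  define M where "M a b = (if b = a - 1 then real a else 0) + (if b = Suc a then 1 else 0)" for a b :: nat
  have sumM: "(\<Sum>b\<in>{1..i}. M a b * f b) = (if 2 \<le> a then real a * f (a - 1) else 0) + (if a < i then f (Suc a) else 0)"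
    if "a \<in> {1..i}" for a f
  proof -
    have "(\<Sum>b\<in>{1..i}. M a b * f b) = (\<Sum>b\<in>{1..i}. (if b = a - 1 then real a * f b else 0) + (if b = Suc a then f b else 0))"
      by (intro sum.cong) (auto simp: M_def)
    also have "\<dots> = (if a - 1 \<in> {1..i} then real a * f (a - 1) else 0) + (if Suc a \<in> {1..i} then f (Suc a) else 0)"
      by (simp add: sum.distrib)
    finally show ?thesis using that by auto
  qed
  obtain W c0 where W: "c0 < c" "\<And>a. a \<in> {1..i} \<Longrightarrow> W a > 0"
    "\<And>a. a \<in> {1..i} \<Longrightarrow> (\<Sum>b\<in>{1..i}. M a b * W b) \<le> c0 * W a"
  proof (rule strict_supersolution[of "{1..i}" c M "\<lambda>k. hermite k c" "\<lambda>k. k"])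
    fix a assume a: "a \<in> {1..i}"
    have pos: "hermite (a - 1) c > 0" "a < i \<Longrightarrow> hermite (Suc a) c > 0" using c(3) a by auto
    show "(\<Sum>b\<in>{1..i}. M a b * hermite b c) \<le> c * hermite a c"
      using hermite_rec[of a c] pos a c(2) unfolding sumM[OF a] by (cases "a < i") (auto simp: not_less le_antisym)
    show "(\<Sum>b\<in>{1..i}. M a b * hermite b c) < c * hermite a c \<or> (\<exists>b\<in>{1..i}. M a b > 0 \<and> b < a)"
    proof (cases "2 \<le> a")
      case True
      then show ?thesis using a by (intro disjI2 bexI[of _ "a - 1"]) (auto simp: M_def)
    next
      case False
      then have "a = 1" using a by simp
      then show ?thesis using hermite_rec[of a c] c(2) i unfolding sumM[OF a] by (cases "i = 1") auto
    qed
  qed (use c in \<open>auto simp: M_def\<close>)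
  define c' where "c' = (c0 + c) / 2"
  have c': "c0 < c'" "c' < c" using W(1) by (auto simp: c'_def)
  \<comment> \<open>Level 0 is restored with a value so small that its contribution at level 1 is
    exactly the slack between \<open>c0\<close> and \<open>c'\<close>.\<close>
  define V where "V a = (if a = 0 then (c' - c0) * W 1 else if a \<le> i then W a else 0)" for a
  show thesis
  proof (rule that[of c' V])
    fix a assume a: "1 \<le> a" "a \<le> i"
    then have a': "a \<in> {1..i}" by simp
    have "(if 2 \<le> a then real a * W (a - 1) else 0) + (if a < i then W (Suc a) else 0) \<le> c0 * W a"
      using W(3)[OF a'] unfolding sumM[OF a'] .
    moreover have "V (Suc a) = (if a < i then W (Suc a) else 0)" by (auto simp: V_def)
    moreover have "real a * V (a - 1) \<le> (if 2 \<le> a then real a * W (a - 1) else 0) + (c' - c0) * W a"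
      using c'(1) W(2)[OF a'] a by (cases "a = 1") (auto simp: V_def)
    ultimately show "real a * V (a - 1) + V (Suc a) \<le> c' * V a"
      using a by (simp add: V_def algebra_simps)
  qed (use c' W i in \<open>auto simp: V_def\<close>)
qed

lemma grid_profile:
  assumes i: "i \<ge> 1" and c: "c > 0" "hermite (Suc i) c = 0" "\<And>k. k \<le> i \<Longrightarrow> hermite k c > 0"
    and \<alpha>: "0 < \<alpha>" "\<alpha> < 1"
  obtains W c' where "c' < c" "\<And>p q. p + q \<le> i \<Longrightarrow> (p, q) \<noteq> (0, i) \<Longrightarrow> W p q > 0"
    "\<And>p q. \<not> (p + q \<le> i \<and> (p, q) \<noteq> (0, i)) \<Longrightarrow> W p q = 0"
    "\<And>p q. p + q \<le> i \<Longrightarrow> (p, q) \<noteq> (0, i) \<Longrightarrow>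
       real p * W (p - 1) q + real q * W p (q - 1) + \<alpha> * W (Suc p) q + (1 - \<alpha>) * W p (Suc q) \<le> c' * W p q"
proof -
  define X where "X = {(p, q). p + q \<le> i \<and> (p, q) \<noteq> (0, i)}"
  have fin: "finite X" by (rule finite_subset[of _ "{..i} \<times> {..i}"]) (auto simp: X_def)
  define M where "M x y = (case x of (p, q) \<Rightarrow>
    (if y = (p - 1, q) then real p else 0) + (if y = (p, q - 1) then real q else 0) +
    (if y = (Suc p, q) then \<alpha> else 0) + (if y = (p, Suc q) then 1 - \<alpha> else 0))" for x y :: "nat \<times> nat"
  \<comment> \<open>Extension by zero, so that boundary terms need no cases; at p = 0 or q = 0 the
    truncated subtraction is harmless because its coefficient is 0.\<close>
  define ext where "ext f p q = (if (p, q) \<in> X then f (p, q) else 0)" for f :: "nat \<times> nat \<Rightarrow> real" and p q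
  have sumM: "(\<Sum>y\<in>X. M (p, q) y * f y) = real p * ext f (p - 1) q + real q * ext f p (q - 1)
     + \<alpha> * ext f (Suc p) q + (1 - \<alpha>) * ext f p (Suc q)" for p q f
  proof -
    have "(\<Sum>y\<in>X. M (p, q) y * f y) = (\<Sum>y\<in>X. (if y = (p - 1, q) then real p * f y else 0)
        + (if y = (p, q - 1) then real q * f y else 0) + (if y = (Suc p, q) then \<alpha> * f y else 0)
        + (if y = (p, Suc q) then (1 - \<alpha>) * f y else 0))"
      by (intro sum.cong) (auto simp: M_def distrib_right)
    then show ?thesis using fin by (simp add: sum.distrib ext_def)
  qed
  define H where "H x = hermite (fst x + snd x) c" for x
  have Hpos: "H x > 0" if "x \<in> X" for x using that c(3) by (auto simp: X_def H_def)
  have ext_le: "ext H p q \<le> hermite (p + q) c" if "p + q \<le> Suc i" for p q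
    using that c(2) c(3)[of "p + q"] by (cases "p + q = Suc i") (auto simp: ext_def H_def)
  have rec: "real p * hermite (p - 1 + q) c + real q * hermite (p + (q - 1)) c + \<alpha> * hermite (Suc (p + q)) c
      + (1 - \<alpha>) * hermite (Suc (p + q)) c = c * hermite (p + q) c" for p q
  proof -
    have A: "real p * hermite (p - 1 + q) c = real p * hermite (p + q - 1) c" by (cases p) auto
    have B: "real q * hermite (p + (q - 1)) c = real q * hermite (p + q - 1) c" by (cases q) auto
    show ?thesis using hermite_rec[of "p + q" c] unfolding A B by (simp add: algebra_simps)
  qed
  have le: "(\<Sum>y\<in>X. M (p, q) y * H y) \<le> c * hermite (p + q) c
      - (if (p, Suc q) = (0, i) then (1 - \<alpha>) * hermite i c else 0)" if "p + q \<le> i" for p q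
  proof -
    have "real p * ext H (p - 1) q \<le> real p * hermite (p - 1 + q) c"
      "real q * ext H p (q - 1) \<le> real q * hermite (p + (q - 1)) c"
      using that by (auto intro!: mult_left_mono ext_le)
    moreover have "\<alpha> * ext H (Suc p) q \<le> \<alpha> * hermite (Suc (p + q)) c"
      using that \<alpha> ext_le[of "Suc p" q] by (auto intro!: mult_left_mono)
    moreover have "(1 - \<alpha>) * ext H p (Suc q) \<le> (1 - \<alpha>) * hermite (Suc (p + q)) c
       - (if (p, Suc q) = (0, i) then (1 - \<alpha>) * hermite i c else 0)"
      using that \<alpha> ext_le[of p "Suc q"] by (auto intro!: mult_left_mono simp: ext_def X_def)
    ultimately show ?thesis unfolding sumM using rec[of p q] by linarith
  qed
  obtain W c' where W: "c' < c" "\<And>x. x \<in> X \<Longrightarrow> W x > 0"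
    "\<And>x. x \<in> X \<Longrightarrow> (\<Sum>y\<in>X. M x y * W y) \<le> c' * W x"
  \<comment> \<open>The rank counts the steps to (0, i - 1): lower \<open>p\<close> to 0, then raise
    \<open>q\<close>. No step hits the corner, since p > 0 forces q < i.\<close>
  proof (rule strict_supersolution[of X c M H "\<lambda>(p, q). p + (i - 1 - q)"])
    fix x assume x: "x \<in> X"
    obtain p q where pq: "x = (p, q)" "p + q \<le> i" "(p, q) \<noteq> (0, i)" using x by (auto simp: X_def)
    have nn: "(1 - \<alpha>) * hermite i c > 0" using \<alpha> c(3) by simp
    show "(\<Sum>y\<in>X. M x y * H y) \<le> c * H x"
      using le[OF pq(2)] nn unfolding pq(1) by (auto simp: H_def split: if_splits)
    show "(\<Sum>y\<in>X. M x y * H y) < c * H x \<or>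
      (\<exists>y\<in>X. M x y > 0 \<and> (case y of (p, q) \<Rightarrow> p + (i - 1 - q)) < (case x of (p, q) \<Rightarrow> p + (i - 1 - q)))"
    proof (cases "p = 0")
      case False
      then show ?thesis using pq \<alpha>
        by (intro disjI2 bexI[of _ "(p - 1, q)"]) (auto simp: M_def X_def)
    next
      case True
      show ?thesis
      proof (cases "Suc q = i")
        case True
        then show ?thesis using le[OF pq(2)] nn \<open>p = 0\<close> unfolding pq(1) by (auto simp: H_def)
      next
        case False
        then have "q < i - 1" using pq True by auto
        then show ?thesis using pq True \<alpha> by (intro disjI2 bexI[of _ "(0, Suc q)"]) (auto simp: M_def X_def)
      qed
    qed
  qed (use fin c Hpos \<alpha> in \<open>auto simp: M_def split: prod.splits\<close>)
  show thesis
  proof (rule that[of c' "ext W"])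
    show "real p * ext W (p - 1) q + real q * ext W p (q - 1) + \<alpha> * ext W (Suc p) q + (1 - \<alpha>) * ext W p (Suc q) \<le> c' * ext W p q"
      if "p + q \<le> i" "(p, q) \<noteq> (0, i)" for p q
      using W(3)[of "(p, q)"] that unfolding sumM by (simp add: ext_def X_def)
  qed (use W in \<open>auto simp: ext_def X_def\<close>)
qed

section \<open>Decay of eigenfunctions on compressed families\<close>

text \<open>Let \<open>p\<close> maximise x / w. If \<open>p\<close> were not \<open>z\<close> and
  the maximum were positive, the equation for \<open>x\<close> and the strict inequality for
  \<open>w\<close> at \<open>p\<close> would contradict each other.\<close>

lemma maximum_principle:
  assumes fin: "finite F" and x: "\<And>u. u \<in> F \<Longrightarrow> 0 \<le> x u" and w: "\<And>u. u \<in> F \<Longrightarrow> 0 < w u"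
    and eig: "\<And>u. u \<in> F \<Longrightarrow> u \<noteq> z \<Longrightarrow> \<theta> * x u = nbsum F E x u"
    and super: "\<And>u. u \<in> F \<Longrightarrow> u \<noteq> z \<Longrightarrow> nbsum F E w u < \<theta> * w u"
    and z: "z \<in> F" and u: "u \<in> F"
  shows "x u \<le> x z / w z * w u"
proof -
  define \<rho> where "\<rho> = Max ((\<lambda>v. x v / w v) ` F)"
  have "\<rho> \<in> (\<lambda>v. x v / w v) ` F" unfolding \<rho>_def using fin z by (intro Max_in) auto
  then obtain p where p: "p \<in> F" "\<rho> = x p / w p" by auto
  have le: "x v \<le> \<rho> * w v" if "v \<in> F" for v
  proof -
    have "x v / w v \<le> \<rho>" unfolding \<rho>_def using fin that by (intro Max_ge) auto
    then show ?thesis using w[OF that] by (simp add: pos_divide_le_eq)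
  qed
  have "\<rho> \<ge> 0" using p x w[of p] by simp
  have "\<rho> \<le> x z / w z"
  proof (cases "p = z \<or> \<rho> = 0")
    case True
    then show ?thesis using p x[OF z] w[OF z] by auto
  next
    case False
    then have "\<rho> > 0" using \<open>\<rho> \<ge> 0\<close> by simp
    have "\<theta> * x p = nbsum F E x p" using eig p False by auto
    also have "\<dots> \<le> nbsum F E (\<lambda>v. \<rho> * w v) p" using le by (intro nbsum_mono) auto
    also have "\<dots> = \<rho> * nbsum F E w p" by (rule nbsum_scale)
    also have "\<dots> < \<rho> * (\<theta> * w p)" 
      using super[of p] p False \<open>\<rho> > 0\<close> by (intro mult_strict_left_mono) auto
    also have "\<dots> = \<theta> * x p" using p w[of p] by simp
    finally show ?thesis by simp
  qed
  then have "\<rho> * w u \<le> x z / w z * w u" using w[OF u] by (intro mult_right_mono) auto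
  then show ?thesis using le[OF u] by simp
qed

section \<open>Neighbour sums in the cube and the weight built from the profiles\<close>

lemma nbsum_restrict:
  assumes "finite V" "F \<subseteq> V"
  shows "nbsum F E w u = nbsum V E (\<lambda>v. if v \<in> F then w v else 0) u"
proof -
  have "nbsum V E (\<lambda>v. if v \<in> F then w v else 0) u = (\<Sum>v\<in>V. if v \<in> F then if E u v then w v else 0 else 0)"
    unfolding nbsum_def by (intro sum.cong) auto
  also have "\<dots> = (\<Sum>v\<in>V \<inter> F. if E u v then w v else 0)"
    using assms(1) by (simp add: sum.inter_restrict)
  finally show ?thesis using assms(2) by (simp add: nbsum_def inf_absorb2)
qed

lemma nbsum_cube:
  assumes "finite X" "u \<subseteq> X"
  shows "nbsum (Pow X) cube_adj w u = (\<Sum>j\<in>X \<inter> u. w (u - {j})) + (\<Sum>j\<in>X - u. w (insert j u))"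
proof -
  let ?g = "\<lambda>j. sym_diff u {j}"
  have eq: "{v \<in> Pow X. cube_adj u v} = ?g ` X"
  proof
    show "{v \<in> Pow X. cube_adj u v} \<subseteq> ?g ` X"
    proof
      fix v assume v: "v \<in> {v \<in> Pow X. cube_adj u v}"
      then have "card (sym_diff u v) = 1" by (simp add: cube_adj_def)
      then obtain a where a: "sym_diff u v = {a}" by (rule card_1_singletonE)
      then have "v = ?g a" by auto
      moreover have "a \<in> X" using a v assms(2) by auto
      ultimately show "v \<in> ?g ` X" by blast
    qed
    have "sym_diff u (?g j) = {j}" for j by auto
    then show "?g ` X \<subseteq> {v \<in> Pow X. cube_adj u v}" using assms(2) by (auto simp: cube_adj_def)
  qed
  have inj: "inj_on ?g X" by (rule inj_onI) auto
  have "nbsum (Pow X) cube_adj w u = (\<Sum>v\<in>{v \<in> Pow X. cube_adj u v}. w v)"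
    unfolding nbsum_def using assms(1) by (intro sum.inter_filter[symmetric]) simp
  also have "\<dots> = (\<Sum>j\<in>X. w (?g j))" unfolding eq using inj by (simp add: sum.reindex)
  also have "\<dots> = (\<Sum>j\<in>X \<inter> u. w (?g j)) + (\<Sum>j\<in>X - u. w (?g j))"
    using assms(1) by (subst sum.union_disjoint[symmetric]) (auto intro: sum.cong)
  also have "(\<Sum>j\<in>X \<inter> u. w (?g j)) = (\<Sum>j\<in>X \<inter> u. w (u - {j}))"
    by (intro sum.cong arg_cong[of _ _ w]) auto
  also have "(\<Sum>j\<in>X - u. w (?g j)) = (\<Sum>j\<in>X - u. w (insert j u))"
    by (intro sum.cong arg_cong[of _ _ w]) auto
  finally show ?thesis .
qed

lemma nbsum_cube_le:
  assumes "finite X" "u \<subseteq> X" "\<And>v. 0 \<le> w v" and F: "F \<subseteq> Pow X"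
  shows "nbsum F cube_adj w u \<le> (\<Sum>j\<in>X \<inter> u. w (u - {j})) + (\<Sum>j\<in>X - u. w (insert j u))"
proof -
  have "nbsum F cube_adj w u = nbsum (Pow X) cube_adj (\<lambda>v. if v \<in> F then w v else 0) u"
    using assms by (intro nbsum_restrict) auto
  also have "\<dots> \<le> nbsum (Pow X) cube_adj w u" using assms(3) by (intro nbsum_mono) auto
  finally show ?thesis using nbsum_cube[OF assms(1,2)] by simp
qed

text \<open>Joins the two profiles under a common rate \<open>c'\<close>, a positive lower bound
  \<open>m\<close> on the indices that occur and an upper bound \<open>B\<close>. The cuts
  \<open>t\<close> and \<open>r\<close> separate \<open>S\<close> and the two intervals;
  \<open>s\<close> stands for sqrt d.\<close>

locale decay_setup =
  fixes d t r i :: nat and V :: "nat \<Rightarrow> real" and W :: "nat \<Rightarrow> nat \<Rightarrow> real"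
    and \<alpha> \<beta> s c' B m :: real
  assumes t: "t \<le> r" "r \<le> d" and s: "s > 0" "s\<^sup>2 = real d" and \<beta>: "\<beta> \<ge> 1"
    and V_pos: "\<And>a. a \<le> i \<Longrightarrow> m \<le> V a" and V_zero: "\<And>a. a > i \<Longrightarrow> V a = 0"
    and W_pos: "\<And>p q. p + q \<le> i \<Longrightarrow> (p, q) \<noteq> (0, i) \<Longrightarrow> m \<le> W p q"
    and W_zero: "\<And>p q. \<not> (p + q \<le> i \<and> (p, q) \<noteq> (0, i)) \<Longrightarrow> W p q = 0"
    and m: "m > 0" and V_le: "\<And>a. V a \<le> B" and W_le: "\<And>p q. W p q \<le> B"
    and V_super: "\<And>a. 1 \<le> a \<Longrightarrow> a \<le> i \<Longrightarrow> real a * V (a - 1) + V (Suc a) \<le> c' * V a"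
    and W_super: "\<And>p q. p + q \<le> i \<Longrightarrow> (p, q) \<noteq> (0, i) \<Longrightarrow>
       real p * W (p - 1) q + real q * W p (q - 1) + \<alpha> * W (Suc p) q + (1 - \<alpha>) * W p (Suc q) \<le> c' * W p q"
    and parts: "real (r - t) \<le> \<alpha> * real d" "real (d - r) \<le> (1 - \<alpha>) * real d"
begin

abbreviation "S \<equiv> {1..t}"
abbreviation "L1 \<equiv> {t<..r}"
abbreviation "L2 \<equiv> {r<..d}"

definition profile :: "nat set \<Rightarrow> real" where
  "profile u = (if u \<inter> S = {} then V (card u) else W (card (u \<inter> L1)) (card (u \<inter> L2)))"

text \<open>The factor \<open>\<beta>\<close> controls moves inside \<open>S\<close>: up to profile
  values, deleting an element of \<open>S\<close> multiplies the weight by s / \<beta> and inserting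
  one by \<beta> / s, with at most \<open>card (u \<inter> S)\<close> and \<open>t\<close> such
  moves.\<close>

definition weight :: "nat set \<Rightarrow> real" where
  "weight u = \<beta> ^ card (u \<inter> S) / s ^ card u * profile u"

definition feasible :: "nat set \<Rightarrow> bool" where
  "feasible u \<longleftrightarrow> u \<subseteq> {1..d} \<and> card (u \<inter> L1) + card (u \<inter> L2) \<le> i \<and>
     (u \<inter> S \<noteq> {} \<longrightarrow> (card (u \<inter> L1), card (u \<inter> L2)) \<noteq> (0, i))"

lemma V_nonneg: "0 \<le> V a" using V_pos[of a] V_zero[of a] m by (cases "a \<le> i") auto
lemma W_nonneg: "0 \<le> W p q" using W_pos[of p q] W_zero[of p q] m by (cases "p + q \<le> i \<and> (p, q) \<noteq> (0, i)") auto

lemma profile_bounds: "0 \<le> profile u" "profile u \<le> B"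
  unfolding profile_def using V_nonneg W_nonneg V_le W_le by auto

lemma weight_nonneg: "0 \<le> weight u"
  unfolding weight_def using profile_bounds s \<beta> by auto

lemma card_split:
  assumes "u \<subseteq> {1..d}"
  shows "card u = card (u \<inter> S) + card (u \<inter> L1) + card (u \<inter> L2)"
proof -
  have fin: "finite u" using assms finite_subset by blast
  have "u = (u \<inter> S) \<union> (u \<inter> L1) \<union> (u \<inter> L2)" using assms by auto
  then have "card u = card ((u \<inter> S) \<union> (u \<inter> L1) \<union> (u \<inter> L2))" by simp
  also have "\<dots> = card ((u \<inter> S) \<union> (u \<inter> L1)) + card (u \<inter> L2)"
    using t fin by (intro card_Un_disjoint) auto
  also have "card ((u \<inter> S) \<union> (u \<inter> L1)) = card (u \<inter> S) + card (u \<inter> L1)"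
    using fin by (intro card_Un_disjoint) auto
  finally show ?thesis .
qed

lemma profile_feasible:
  assumes "feasible u" shows "m \<le> profile u"
proof (cases "u \<inter> S = {}")
  case True
  then have "card u \<le> i" using assms card_split[of u] unfolding feasible_def by simp
  then show ?thesis using True V_pos by (simp add: profile_def)
next
  case False
  then have "m \<le> W (card (u \<inter> L1)) (card (u \<inter> L2))"
    using assms unfolding feasible_def by (intro W_pos) blast+
  then show ?thesis using False by (simp add: profile_def)
qed

lemma sum_le_card:
  fixes f :: "nat \<Rightarrow> real"
  assumes "finite A" "\<And>j. j \<in> A \<Longrightarrow> f j \<le> k" "real (card A) \<le> n" "0 \<le> k"
  shows "sum f A \<le> n * k"
proof -
  have "sum f A \<le> real (card A) * k" using sum_bounded_above[of A f k] assms by simp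
  also have "\<dots> \<le> n * k" using assms by (intro mult_right_mono) auto
  finally show ?thesis .
qed

text \<open>Neighbours fall into six groups: deletions and insertions in \<open>S\<close>,
  \<open>L1\<close> and \<open>L2\<close>. The four groups outside \<open>S\<close> reproduce the
  profile inequality scaled by \<open>s\<close>; the two in \<open>S\<close> are bounded crudely
  through \<open>B\<close> and form the error term.\<close>

lemma neighbour_sum:
  assumes u: "feasible u" "u \<noteq> {}" and F: "F \<subseteq> Pow {1..d}"
  shows "nbsum F cube_adj weight u \<le> \<beta> ^ card (u \<inter> S) / s ^ card u *
    (s * (c' * profile u + (real (card (u \<inter> S)) / \<beta> + real t * \<beta> / real d) * B))"
proof -
  have ud: "u \<subseteq> {1..d}" using u by (simp add: feasible_def)
  then have fin: "finite u" using finite_subset by blast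
  have k: "card u > 0" using u fin by (simp add: card_gt_0_iff)
  define D where "D = \<beta> ^ card (u \<inter> S) / s ^ card u"
  define p where "p = card (u \<inter> L1)"
  define q where "q = card (u \<inter> L2)"
  have D: "D > 0" using s \<beta> by (simp add: D_def)
  have B: "B \<ge> 0" using V_nonneg[of 0] V_le[of 0] by simp
  have dpos: "real d > 0" using s by (metis zero_less_power)
  have sd: "real d = s * s" using s by (simp add: power2_eq_square)
  have down_S: "weight (u - {j}) \<le> D * (s / \<beta> * B)" if "j \<in> u" "j \<in> S" for j
  proof -
    have c1: "card u = Suc (card (u - {j}))" using card_Suc_Diff1[OF fin that(1)] by simp
    have "(u - {j}) \<inter> S = u \<inter> S - {j}" by auto
    moreover have "card (u \<inter> S) = Suc (card (u \<inter> S - {j}))" using card_Suc_Diff1[of "u \<inter> S" j] fin that by simp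
    ultimately have c2: "card (u \<inter> S) = Suc (card ((u - {j}) \<inter> S))" by simp
    have "weight (u - {j}) = D * (s / \<beta> * profile (u - {j}))"
      unfolding weight_def D_def c1 c2 using s \<beta> by (simp add: mult_ac)
    also have "\<dots> \<le> D * (s / \<beta> * B)" using D s \<beta> profile_bounds by (intro mult_left_mono) auto
    finally show ?thesis .
  qed
  have up_S: "weight (insert j u) \<le> D * (\<beta> / s * B)" if "j \<notin> u" "j \<in> S" for j
  proof -
    have c1: "card (insert j u) = Suc (card u)" using fin that by simp
    have "insert j u \<inter> S = insert j (u \<inter> S)" using that by auto
    then have c2: "card (insert j u \<inter> S) = Suc (card (u \<inter> S))" using fin that by simp
    have "weight (insert j u) = D * (\<beta> / s * profile (insert j u))"
      unfolding weight_def D_def c1 c2 using s \<beta> by (simp add: mult_ac)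
    also have "\<dots> \<le> D * (\<beta> / s * B)" using D s \<beta> profile_bounds by (intro mult_left_mono) auto
    finally show ?thesis .
  qed
  have down_L: "weight (u - {j}) = D * (s * profile (u - {j}))" if "j \<in> u" "j \<notin> S" for j
  proof -
    have c1: "card u = Suc (card (u - {j}))" using card_Suc_Diff1[OF fin that(1)] by simp
    have c2: "(u - {j}) \<inter> S = u \<inter> S" using that by auto
    show ?thesis unfolding weight_def D_def c1 c2 using s by (simp add: mult_ac)
  qed
  have up_L: "weight (insert j u) = D * (1 / s * profile (insert j u))" if "j \<notin> u" "j \<notin> S" for j
  proof -
    have c1: "card (insert j u) = Suc (card u)" using fin that by simp
    have c2: "insert j u \<inter> S = u \<inter> S" using that by auto
    show ?thesis unfolding weight_def D_def c1 c2 using s by (simp add: mult_ac)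
  qed
  have pr: "profile (u - {j}) = (if u \<inter> S = {} then V (card u - 1) else W (p - 1) q)" if "j \<in> u" "j \<in> L1" for j
  proof -
    have "(u - {j}) \<inter> S = u \<inter> S" "(u - {j}) \<inter> L2 = u \<inter> L2" "(u - {j}) \<inter> L1 = u \<inter> L1 - {j}" using that t by auto
    then show ?thesis using that fin by (auto simp: profile_def p_def q_def)
  qed
  have pr2: "profile (u - {j}) = (if u \<inter> S = {} then V (card u - 1) else W p (q - 1))" if "j \<in> u" "j \<in> L2" for j
  proof -
    have "(u - {j}) \<inter> S = u \<inter> S" "(u - {j}) \<inter> L2 = u \<inter> L2 - {j}" "(u - {j}) \<inter> L1 = u \<inter> L1" using that t by auto
    then show ?thesis using that fin by (auto simp: profile_def p_def q_def)
  qed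
  have pr3: "profile (insert j u) = (if u \<inter> S = {} then V (Suc (card u)) else W (Suc p) q)" if "j \<notin> u" "j \<in> L1" for j
  proof -
    have "insert j u \<inter> S = u \<inter> S" "insert j u \<inter> L2 = u \<inter> L2" "insert j u \<inter> L1 = insert j (u \<inter> L1)" using that t by auto
    then show ?thesis using that fin by (auto simp: profile_def p_def q_def)
  qed
  have pr4: "profile (insert j u) = (if u \<inter> S = {} then V (Suc (card u)) else W p (Suc q))" if "j \<notin> u" "j \<in> L2" for j
  proof -
    have "insert j u \<inter> S = u \<inter> S" "insert j u \<inter> L2 = insert j (u \<inter> L2)" "insert j u \<inter> L1 = u \<inter> L1" using that t by auto
    then show ?thesis using that fin by (auto simp: profile_def p_def q_def)
  qed
  define P1 where "P1 = (if u \<inter> S = {} then V (card u - 1) else W (p - 1) q)"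
  define P2 where "P2 = (if u \<inter> S = {} then V (card u - 1) else W p (q - 1))"
  define P3 where "P3 = (if u \<inter> S = {} then V (Suc (card u)) else W (Suc p) q)"
  define P4 where "P4 = (if u \<inter> S = {} then V (Suc (card u)) else W p (Suc q))"
  have Pn: "P1 \<ge> 0" "P2 \<ge> 0" "P3 \<ge> 0" "P4 \<ge> 0"
    unfolding P1_def P2_def P3_def P4_def using V_nonneg W_nonneg by auto
  have split: "{1..d} = S \<union> L1 \<union> L2" using t by auto
  have split3: "sum f (Y S \<union> Y L1 \<union> Y L2) = sum f (Y S) + sum f (Y L1) + sum f (Y L2)"
    if "\<And>A. Y A \<subseteq> A" for f :: "nat \<Rightarrow> real" and Y
  proof -
    have fY: "finite (Y A)" if "finite A" for A using \<open>\<And>A. Y A \<subseteq> A\<close> that finite_subset by blast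
    have "Y S \<inter> Y L1 = {}" "(Y S \<union> Y L1) \<inter> Y L2 = {}"
      using that[of S] that[of L1] that[of L2] t by fastforce+
    then show ?thesis using fY by (simp add: sum.union_disjoint)
  qed
  have S1: "(\<Sum>j\<in>S \<inter> u. weight (u - {j})) \<le> real (card (u \<inter> S)) * (D * (s / \<beta> * B))"
    using down_S D s \<beta> B by (intro sum_le_card) (auto simp: Int_commute)
  have S2: "(\<Sum>j\<in>L1 \<inter> u. weight (u - {j})) \<le> real p * (D * (s * P1))"
    using down_L pr Pn D s by (intro sum_le_card) (auto simp: Int_commute p_def P1_def)
  have S3: "(\<Sum>j\<in>L2 \<inter> u. weight (u - {j})) \<le> real q * (D * (s * P2))"
    using down_L pr2 Pn D s t by (intro sum_le_card) (auto simp: Int_commute q_def P2_def)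
  have S4: "(\<Sum>j\<in>S - u. weight (insert j u)) \<le> real t * (D * (\<beta> / s * B))"
    using up_S D s \<beta> B card_mono[of S "S - u"] by (intro sum_le_card) auto
  have S5: "(\<Sum>j\<in>L1 - u. weight (insert j u)) \<le> (\<alpha> * real d) * (D * (1 / s * P3))"
    using up_L pr3 Pn D s parts(1) card_mono[of L1 "L1 - u"] by (intro sum_le_card) (auto simp: P3_def)
  have S6: "(\<Sum>j\<in>L2 - u. weight (insert j u)) \<le> ((1 - \<alpha>) * real d) * (D * (1 / s * P4))"
    using up_L pr4 Pn D s t parts(2) card_mono[of L2 "L2 - u"] by (intro sum_le_card) (auto simp: P4_def)
  \<comment> \<open>When \<open>u\<close> avoids \<open>S\<close>, the terms of the two intervals
    merge, since p + q = card u and the proportions add up to 1; nonemptiness of \<open>u\<close>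
    then gives the index at least 1 that \<open>V_super\<close> asks for.\<close>
  have core: "real p * P1 + real q * P2 + \<alpha> * P3 + (1 - \<alpha>) * P4 \<le> c' * profile u"
  proof (cases "u \<inter> S = {}")
    case True
    then have c: "card u = p + q" using card_split[OF ud] by (simp add: p_def q_def)
    then have "1 \<le> card u" "card u \<le> i" using k u(1) by (auto simp: feasible_def p_def q_def)
    then have "real (card u) * V (card u - 1) + V (Suc (card u)) \<le> c' * V (card u)" by (rule V_super)
    then show ?thesis using True unfolding P1_def P2_def P3_def P4_def profile_def c by (simp add: algebra_simps)
  next
    case False
    then have "p + q \<le> i" "(p, q) \<noteq> (0, i)" using u(1) unfolding feasible_def p_def q_def by blast+
    then show ?thesis using W_super[of p q] False
      by (simp add: P1_def P2_def P3_def P4_def profile_def flip: p_def q_def)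
  qed
  have "nbsum F cube_adj weight u \<le>
      (\<Sum>j\<in>{1..d} \<inter> u. weight (u - {j})) + (\<Sum>j\<in>{1..d} - u. weight (insert j u))"
    using F ud weight_nonneg by (intro nbsum_cube_le) auto
  also have "(\<Sum>j\<in>{1..d} \<inter> u. weight (u - {j})) = (\<Sum>j\<in>S \<inter> u. weight (u - {j})) +
      (\<Sum>j\<in>L1 \<inter> u. weight (u - {j})) + (\<Sum>j\<in>L2 \<inter> u. weight (u - {j}))"
    unfolding split Int_Un_distrib2 by (rule split3) auto
  also have "(\<Sum>j\<in>{1..d} - u. weight (insert j u)) = (\<Sum>j\<in>S - u. weight (insert j u)) +
      (\<Sum>j\<in>L1 - u. weight (insert j u)) + (\<Sum>j\<in>L2 - u. weight (insert j u))"
    unfolding split Un_Diff by (rule split3) auto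
  also have "(\<Sum>j\<in>S \<inter> u. weight (u - {j})) + (\<Sum>j\<in>L1 \<inter> u. weight (u - {j})) + (\<Sum>j\<in>L2 \<inter> u. weight (u - {j}))
      + ((\<Sum>j\<in>S - u. weight (insert j u)) + (\<Sum>j\<in>L1 - u. weight (insert j u)) + (\<Sum>j\<in>L2 - u. weight (insert j u)))
    \<le> real (card (u \<inter> S)) * (D * (s / \<beta> * B)) + real p * (D * (s * P1)) + real q * (D * (s * P2))
      + (real t * (D * (\<beta> / s * B)) + (\<alpha> * real d) * (D * (1 / s * P3)) + ((1 - \<alpha>) * real d) * (D * (1 / s * P4)))"
    using S1 S2 S3 S4 S5 S6 by linarith
  also have "\<dots> = D * s * ((real p * P1 + real q * P2 + \<alpha> * P3 + (1 - \<alpha>) * P4)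
      + (real (card (u \<inter> S)) / \<beta> + real t * \<beta> / real d) * B)"
    unfolding sd using s \<beta> by (simp add: field_simps)
  also have "\<dots> \<le> D * s * (c' * profile u + (real (card (u \<inter> S)) / \<beta> + real t * \<beta> / real d) * B)"
    using core D s by (intro mult_left_mono) auto
  finally show ?thesis unfolding D_def by (simp add: mult.assoc)
qed

text \<open>The maximum principle with exceptional vertex {}. The hypothesis on
  \<open>\<theta>\<close> says that the gap between \<theta> / s and \<open>c'\<close>, taken at the
  smallest profile value, exceeds the error from moves in \<open>S\<close>.\<close>

lemma eigenfunction_decay:
  assumes F: "\<And>u. u \<in> F \<Longrightarrow> feasible u" "\<And>u. u \<in> F \<Longrightarrow> real (card u) \<le> K" "{} \<in> F"
    and x: "\<And>u. u \<in> F \<Longrightarrow> 0 \<le> x u" "\<And>u. u \<in> F \<Longrightarrow> nbsum F cube_adj x u = \<theta> * x u"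
    and \<theta>: "(K / \<beta> + real t * \<beta> / real d) * B < (\<theta> / s - c') * m" "c' \<le> \<theta> / s"
    and u: "u \<in> F"
  shows "x u \<le> B / V 0 * x {} * (\<beta> / s) ^ card u"
proof -
  have Fd: "F \<subseteq> Pow {1..d}" using F(1) by (auto simp: feasible_def)
  have fin: "finite F" using Fd finite_subset by auto
  have B: "B \<ge> 0" using V_nonneg[of 0] V_le[of 0] by simp
  have pos: "weight v > 0" if "v \<in> F" for v
    using profile_feasible[OF F(1)[OF that]] m s \<beta> unfolding weight_def by simp
  have super: "nbsum F cube_adj weight v < \<theta> * weight v" if v: "v \<in> F" "v \<noteq> {}" for v
  proof -
    define D where "D = \<beta> ^ card (v \<inter> S) / s ^ card v"
    have D: "D > 0" using s \<beta> by (simp add: D_def)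
    have "finite v" using v Fd finite_subset by blast
    then have "card (v \<inter> S) \<le> card v" by (intro card_mono) auto
    then have "real (card (v \<inter> S)) \<le> K" using F(2)[OF v(1)] by simp
    then have "real (card (v \<inter> S)) / \<beta> \<le> K / \<beta>" using \<beta> by (intro divide_right_mono) auto
    then have "(real (card (v \<inter> S)) / \<beta> + real t * \<beta> / real d) * B \<le> (K / \<beta> + real t * \<beta> / real d) * B"
      using B by (intro mult_right_mono) auto
    also have "\<dots> < (\<theta> / s - c') * m" by (rule \<theta>)
    also have "\<dots> \<le> (\<theta> / s - c') * profile v"
      using \<theta>(2) profile_feasible[OF F(1)[OF v(1)]] by (intro mult_left_mono) auto
    finally have "c' * profile v + (real (card (v \<inter> S)) / \<beta> + real t * \<beta> / real d) * B < \<theta> / s * profile v"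
      by (simp add: algebra_simps)
    then have "D * (s * (c' * profile v + (real (card (v \<inter> S)) / \<beta> + real t * \<beta> / real d) * B)) < D * (s * (\<theta> / s * profile v))"
      using D s by (intro mult_strict_left_mono) auto
    also have "\<dots> = \<theta> * weight v" using s by (simp add: weight_def D_def)
    finally show ?thesis using neighbour_sum[OF F(1)[OF v(1)] v(2) Fd] unfolding D_def by linarith
  qed
  have "x u \<le> x {} / weight {} * weight u"
  proof (rule maximum_principle[OF fin _ pos _ super F(3) u])
    show "\<theta> * x v = nbsum F cube_adj x v" if "v \<in> F" for v using x(2)[OF that] by simp
  qed (use x in auto)
  also have "weight {} = V 0" by (simp add: weight_def profile_def)
  also have "x {} / V 0 * weight u \<le> x {} / V 0 * (B * (\<beta> / s) ^ card u)"
  proof (intro mult_left_mono)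
    have "finite u" using u Fd finite_subset by blast
    then have "card (u \<inter> S) \<le> card u" by (intro card_mono) auto
    then have "\<beta> ^ card (u \<inter> S) \<le> \<beta> ^ card u" using \<beta> by (intro power_increasing) auto
    then have "weight u \<le> \<beta> ^ card u / s ^ card u * B"
      unfolding weight_def using s \<beta> profile_bounds by (intro mult_mono divide_right_mono) auto
    then show "weight u \<le> B * (\<beta> / s) ^ card u" by (simp add: power_divide mult.commute)
    show "0 \<le> x {} / V 0" using x(1)[OF F(3)] V_nonneg by simp
  qed
  finally show ?thesis by (simp add: mult_ac)
qed

end

section \<open>The decay hypotheses for large dimension\<close>

definition low_sets :: "nat \<Rightarrow> nat \<Rightarrow> nat set set" where
  "low_sets d i = {A. A \<subseteq> {1..d} \<and> card A \<le> i}"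

lemma finite_low_sets: "finite (low_sets d i)"
  by (rule finite_subset[of _ "Pow {1..d}"]) (auto simp: low_sets_def)

lemma card_low_sets: "card (low_sets d i) = (\<Sum>k\<le>i. d choose k)"
proof -
  have "low_sets d i = (\<Union>k\<le>i. {A. A \<subseteq> {1..d} \<and> card A = k})" by (auto simp: low_sets_def)
  also have "card \<dots> = (\<Sum>k\<le>i. card {A. A \<subseteq> {1..d} \<and> card A = k})"
    by (intro card_UN_disjoint) auto
  finally show ?thesis by (simp add: n_subsets)
qed

lemma binomial_le_power: "d choose k \<le> d ^ k"
proof -
  have "d choose k \<le> (d choose k) * fact k" using fact_ge_1[of k, where ?'a = nat] by simp
  also have "\<dots> \<le> d ^ k" by (rule binomial_fact_pow)
  finally show ?thesis .
qed

text \<open>The falling factorial is at least (n - k)^k. Its leading constant is sharp, as the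
  comparison at the large cut requires.\<close>

lemma power_le_fact_binomial: "(n - k) ^ k \<le> fact k * (n choose k)"
proof (induction k)
  case (Suc k)
  have "(n - Suc k) ^ Suc k \<le> (n - k) * (n - k) ^ k"
    by (simp add: mult_mono power_mono)
  also have "\<dots> \<le> (n - k) * (fact k * (n choose k))" using Suc by simp
  also have "\<dots> = fact k * ((n - k) * (n choose k))" by (simp add: algebra_simps)
  also have "(n - k) * (n choose k) = Suc k * (n choose Suc k)"
    by (simp only: binomial_absorb_comp binomial_absorption)
  finally show ?case by (simp add: algebra_simps)
qed simp

lemma card_low_sets_le:
  assumes "d \<ge> 1"
  shows "card (low_sets d i) \<le> Suc i * d ^ i"
proof -
  have "(\<Sum>k\<le>i. d choose k) \<le> (\<Sum>k\<le>i. d ^ i)"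
  proof (intro sum_mono)
    fix k assume "k \<in> {..i}"
    then have "d ^ k \<le> d ^ i" using assms by (intro power_increasing) auto
    then show "d choose k \<le> d ^ i" using binomial_le_power[of d k] by simp
  qed
  then show ?thesis by (simp add: card_low_sets)
qed

text \<open>Keeps the top binomial coefficient exact: at the large cut only a constant factor is
  available, for which \<open>Suc i * d ^ i\<close> would be too weak.\<close>

lemma card_low_sets_le':
  assumes "d \<ge> 1" "i \<ge> 1"
  shows "card (low_sets d i) \<le> (d choose i) + i * d ^ (i - 1)"
proof -
  have "(\<Sum>k<i. d choose k) \<le> (\<Sum>k<i. d ^ (i - 1))"
  proof (intro sum_mono)
    fix k assume "k \<in> {..<i}"
    then have "d ^ k \<le> d ^ (i - 1)" using assms by (intro power_increasing) auto
    then show "d choose k \<le> d ^ (i - 1)" using binomial_le_power[of d k] by simp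
  qed
  moreover have "(\<Sum>k\<le>i. d choose k) = (\<Sum>k<i. d choose k) + (d choose i)"
    by (simp add: lessThan_Suc_atMost[symmetric])
  ultimately show ?thesis by (simp add: card_low_sets)
qed

text \<open>If a member had i + 1 elements beyond \<open>t\<close>, shifting them left would put
  every (i + 1)-subset of {1..t} into \<open>F\<close>.\<close>

lemma compressed_few_large:
  assumes F: "compressed F" "F \<subseteq> Pow {1..d}" and card: "card F < t choose Suc i" and u: "u \<in> F"
  shows "card (u \<inter> {t<..d}) \<le> i"
proof (rule ccontr)
  assume n: "\<not> card (u \<inter> {t<..d}) \<le> i"
  have finF: "finite F" using F(2) finite_subset by auto
  have finu: "finite u" using F(2) u finite_subset by blast
  have "Suc i \<le> card (u \<inter> {t<..d})" using n by simp
  then obtain A where A: "A \<subseteq> u \<inter> {t<..d}" "card A = Suc i" "finite A"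
    by (rule obtain_subset_with_card_n)
  then have AF: "A \<in> F" using compressed_subset[OF F(1) u _ finu] by auto
  have "{A'. A' \<subseteq> {1..t} \<and> card A' = Suc i} \<subseteq> F"
  proof clarify
    fix A' assume A': "A' \<subseteq> {1..t}" "card A' = Suc i"
    have "{} \<union> A' \<in> F"
    proof (rule compressed_shift[OF F(1) A(3)])
      show "1 \<le> a' \<and> a' < a" if "a \<in> A" "a' \<in> A'" for a a'
        using that A(1) A'(1) by (meson IntD2 atLeastAtMost_iff greaterThanAtMost_iff le_less_trans subsetD)
      show "finite A'" using A' finite_subset by blast
    qed (use A' A AF in auto)
    then show "A' \<in> F" by simp
  qed
  then have "card {A'. A' \<subseteq> {1..t} \<and> card A' = Suc i} \<le> card F" using finF by (rule card_mono[rotated])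
  then show False using card by (simp add: n_subsets)
qed

text \<open>Otherwise one element of \<open>S\<close> shifts to 1, and the i elements beyond
  \<open>r\<close> shift to any i-subset of {2..r}. With and without 1, these sets form two disjoint
  families of equal size inside \<open>F\<close>.\<close>

lemma compressed_no_heavy_pair:
  assumes F: "compressed F" "F \<subseteq> Pow {1..d}" and card: "card F < 2 * ((r - 1) choose i)"
    and tr: "t \<le> r" and u: "u \<in> F" "u \<inter> {1..t} \<noteq> {}"
  shows "card (u \<inter> {r<..d}) \<noteq> i"
proof
  assume ci: "card (u \<inter> {r<..d}) = i"
  let ?A = "u \<inter> {r<..d}"
  have finF: "finite F" using F(2) finite_subset by auto
  have finu: "finite u" using F(2) u finite_subset by blast
  obtain a where a: "a \<in> u" "1 \<le> a" "a \<le> t" using u(2) by auto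
  have "?A \<union> {a} \<in> F" using compressed_subset[OF F(1) u(1) _ finu] a by auto
  have one: "?A \<union> {1} \<in> F"
  proof (cases "a = 1")
    case False
    show ?thesis
      by (rule compressed_shift[OF F(1), of "{a}"]) (use False \<open>?A \<union> {a} \<in> F\<close> a tr in auto)
  qed (use \<open>?A \<union> {a} \<in> F\<close> in simp)
  define T where "T = {A'. A' \<subseteq> {2..r} \<and> card A' = i}"
  have finT: "finite T" by (rule finite_subset[of _ "Pow {2..r}"]) (auto simp: T_def)
  have in1: "insert 1 A' \<in> F" if "A' \<in> T" for A'
  proof -
    have "{1} \<union> A' \<in> F"
    proof (rule compressed_shift[OF F(1), of ?A])
      show "1 \<le> a' \<and> a' < a" if "a \<in> ?A" "a' \<in> A'" for a a'
        using that \<open>A' \<in> T\<close> unfolding T_def by fastforce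
      show "finite A'" using that finite_subset unfolding T_def by blast
      show "{1} \<inter> ?A = {}" using a tr by auto
      show "{1} \<union> ?A \<in> F" using one by (simp add: Un_commute)
    qed (use that ci finu in \<open>auto simp: T_def\<close>)
    then show ?thesis by simp
  qed
  have in2: "A' \<in> F" if "A' \<in> T" for A'
  proof -
    have "insert 1 A' \<subseteq> {1..d}" using in1[OF that] F(2) by (metis PowD subsetD)
    then have "finite (insert 1 A')" by (rule finite_subset) simp
    then show ?thesis by (rule compressed_subset[OF F(1) in1[OF that] subset_insertI])
  qed
  have T1: "1 \<notin> A'" if "A' \<in> T" for A' using that unfolding T_def by auto
  have "inj_on (insert 1) T" by (rule inj_onI) (use T1 insert_ident in metis)
  moreover have "T \<inter> insert 1 ` T = {}" using T1 by auto
  ultimately have "card (T \<union> insert 1 ` T) = 2 * card T"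
    using finT by (simp add: card_Un_disjoint card_image)
  moreover have "card T = (r - 1) choose i" unfolding T_def by (simp add: n_subsets)
  moreover have "card (T \<union> insert 1 ` T) \<le> card F" using in1 in2 finF by (intro card_mono) auto
  ultimately show False using card by simp
qed

text \<open>\<open>F\<close> contains the whole power set of \<open>u\<close>. The bound limits the
  number of deletions in \<open>S\<close>.\<close>

lemma compressed_card_le_log:
  assumes F: "compressed F" "F \<subseteq> Pow {1..d}" and card: "real (card F) \<le> b" and u: "u \<in> F"
  shows "real (card u) \<le> log 2 b"
proof -
  have finF: "finite F" using F(2) finite_subset by auto
  have finu: "finite u" using F(2) u finite_subset by blast
  have "Pow u \<subseteq> F" using compressed_subset[OF F(1) u _ finu] by auto
  then have "card (Pow u) \<le> card F" using finF by (rule card_mono[rotated])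
  then have "real (2 ^ card u) \<le> real (card F)" using finu by (simp only: card_Pow of_nat_le_iff)
  then have "real (2 ^ card u) \<le> b" using card by linarith
  then have "2 powr real (card u) \<le> b" by (simp add: powr_realpow)
  moreover have "b > 0" by (rule less_le_trans[OF _ \<open>2 powr real (card u) \<le> b\<close>]) simp
  ultimately show ?thesis by (simp add: le_log_iff)
qed

text \<open>With this exponent t^(i+1) is at least d^(i + 3/4), and the surplus d^(3/4) beats every
  constant that depends on i.\<close>

lemma small_cut_large_enough:
  fixes i :: nat
  defines "\<eta> \<equiv> 1 / (8 * (real i + 1))"
  shows "\<forall>\<^sub>F d in sequentially. Suc i * d ^ i < nat \<lceil>real d powr (1 - 2 * \<eta>)\<rceil> choose Suc i"
proof -
  have "\<forall>\<^sub>F d in sequentially. real d powr (3/4) > real (Suc i) ^ Suc (Suc i)" by real_asymp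
  moreover have "\<forall>\<^sub>F d in sequentially. real d powr (1/2) > real (Suc i)" by real_asymp
  moreover have "\<forall>\<^sub>F d :: nat in sequentially. d \<ge> 1" by (rule eventually_ge_at_top)
  ultimately show ?thesis
  proof eventually_elim
    case (elim d)
    let ?t = "nat \<lceil>real d powr (1 - 2 * \<eta>)\<rceil>"
    have \<eta>: "\<eta> > 0" "\<eta> \<le> 1 / 8" "(1 - 2 * \<eta>) * real (Suc i) = real i + 3 / 4"
      by (auto simp: \<eta>_def field_simps)
    have t: "real ?t \<ge> real d powr (1 - 2 * \<eta>)" by linarith
    have "real d powr (1/2) \<le> real d powr (1 - 2 * \<eta>)" using elim \<eta> by (intro powr_mono) auto
    then have ti: "Suc i \<le> ?t" using t elim by linarith
    have "real (Suc i * d ^ i) * real (Suc i) ^ Suc i = real (Suc i) ^ Suc (Suc i) * real d ^ i" by (simp add: algebra_simps)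
    also have "\<dots> < real d powr (3/4) * real d ^ i" using elim by (intro mult_strict_right_mono) auto
    also have "\<dots> = real d powr ((1 - 2 * \<eta>) * real (Suc i))"
      unfolding \<eta>(3) using elim by (simp add: powr_add powr_realpow)
    also have "\<dots> = (real d powr (1 - 2 * \<eta>)) ^ Suc i" using elim by (simp add: powr_powr[symmetric] powr_realpow del: of_nat_Suc)
    also have "\<dots> \<le> real ?t ^ Suc i" using t by (intro power_mono) auto
    also have "\<dots> = (real ?t / real (Suc i)) ^ Suc i * real (Suc i) ^ Suc i" 
      unfolding power_mult_distrib[symmetric] by (simp del: of_nat_Suc power_Suc)
    also have "\<dots> \<le> real (?t choose Suc i) * real (Suc i) ^ Suc i"
      using binomial_ge_n_over_k_pow_k[OF ti, where ?'a = real] by (intro mult_right_mono) auto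
    finally have "real (Suc i * d ^ i) < real (?t choose Suc i)"
      by (rule mult_right_less_imp_less) simp
    then show ?case by linarith
  qed
qed

text \<open>By Bernoulli \<open>\<alpha> ^ i\<close> is at least 3/4, so twice the number of
  i-subsets below the cut is asymptotically at least 3/2 times d^i / i!. The threshold 5/4 lies
  between this and the constant 1 of the ball.\<close>

lemma large_cut_large_enough:
  fixes i :: nat
  assumes "i \<ge> 1"
  defines "\<alpha> \<equiv> 1 - 1 / (4 * real i)"
  shows "\<forall>\<^sub>F d in sequentially. card (low_sets d i) < 2 * ((nat \<lceil>\<alpha> * real d\<rceil> - 1) choose i)"
proof -
  have \<alpha>: "\<alpha> > 0" "\<alpha> < 1" using assms by (auto simp: \<alpha>_def field_simps)
  have bern: "3 / 4 \<le> \<alpha> ^ i"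
    using Bernoulli_inequality[of "- 1 / (4 * real i)" i] assms by (simp add: field_simps)
  have "(\<lambda>d. 2 * (\<alpha> - (real i + 1) / real d) ^ i) \<longlonglongrightarrow> 2 * (\<alpha> - 0) ^ i"
    by (intro tendsto_intros)
  then have "\<forall>\<^sub>F d in sequentially. 2 * (\<alpha> - (real i + 1) / real d) ^ i > 5 / 4"
    by (rule order_tendstoD) (use bern in simp)
  moreover have "\<forall>\<^sub>F d in sequentially. 1 + real i * fact i / real d < 5 / 4" by real_asymp
  moreover have "\<forall>\<^sub>F d in sequentially. \<alpha> - (real i + 1) / real d > 0"
    using \<alpha> by real_asymp
  moreover have "\<forall>\<^sub>F d :: nat in sequentially. d \<ge> 1" by (rule eventually_ge_at_top)
  ultimately show ?thesis
  proof eventually_elim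
    case (elim d)
    let ?r = "nat \<lceil>\<alpha> * real d\<rceil>"
    have r: "real ?r \<ge> \<alpha> * real d" by linarith
    have d: "real d > 0" using elim by simp
    \<comment> \<open>One element is lost because 1 is set aside, and \<open>i\<close> more through
      \<open>power_le_fact_binomial\<close>.\<close>
    have le: "\<alpha> * real d - (real i + 1) \<le> real (?r - 1 - i)" using r by linarith
    have p: "0 < (\<alpha> - (real i + 1) / real d) * real d" using elim d by simp
    have eq: "(\<alpha> - (real i + 1) / real d) * real d = \<alpha> * real d - (real i + 1)" using d by (simp add: field_simps)
    have "real (card (low_sets d i)) * fact i \<le> real ((d choose i) + i * d ^ (i - 1)) * fact i"
      using elim assms(1) by (intro mult_right_mono of_nat_mono card_low_sets_le') auto
    also have "\<dots> = real ((d choose i) * fact i) + real i * fact i * real d ^ (i - 1)" by (simp add: algebra_simps)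
    also have "\<dots> \<le> real d ^ i + real i * fact i * real d ^ (i - 1)"
      using of_nat_mono[OF binomial_fact_pow[of d i], where ?'a = real] by simp
    also have "\<dots> = (1 + real i * fact i / real d) * real d ^ i"
      using d assms(1) by (cases i) (auto simp: field_simps)
    also have "\<dots> < 2 * (\<alpha> - (real i + 1) / real d) ^ i * real d ^ i"
      by (rule mult_strict_right_mono) (use elim(1,2) d in \<open>linarith, simp\<close>)
    also have "\<dots> = 2 * (\<alpha> * real d - (real i + 1)) ^ i"
      unfolding eq[symmetric] by (simp add: power_mult_distrib)
    also have "\<dots> \<le> 2 * real (?r - 1 - i) ^ i"
      using le p unfolding eq by (intro mult_left_mono power_mono) auto
    also have "\<dots> \<le> 2 * real (fact i * ((?r - 1) choose i))"
      using of_nat_mono[OF power_le_fact_binomial[of "?r - 1" i], where ?'a = real] by simp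
    also have "\<dots> = real (2 * ((?r - 1) choose i)) * fact i" by simp
    finally have "real (card (low_sets d i)) < real (2 * ((?r - 1) choose i))"
      by (rule mult_right_less_imp_less) simp
    then show ?case by linarith
  qed
qed

lemma error_terms_small:
  fixes i :: nat and \<epsilon> :: real
  assumes "\<epsilon> > 0" "i \<ge> 1"
  defines "\<eta> \<equiv> 1 / (8 * (real i + 1))"
  shows "\<forall>\<^sub>F d in sequentially. log 2 (real (Suc i * d ^ i)) / real d powr \<eta>
     + real (nat \<lceil>real d powr (1 - 2 * \<eta>)\<rceil>) * real d powr \<eta> / real d < \<epsilon>"
proof -
  have \<eta>: "\<eta> > 0" "\<eta> \<le> 1 / 8" using assms by (auto simp: \<eta>_def field_simps)
  have "(\<lambda>d. log 2 (real i + 1) / real d powr \<eta> + real i * (log 2 (real d) / real d powr \<eta>)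
      + real d powr (- \<eta>) + real d powr (\<eta> - 1)) \<longlonglongrightarrow> 0"
    using \<eta> by real_asymp
  then have "\<forall>\<^sub>F d in sequentially. log 2 (real i + 1) / real d powr \<eta> + real i * (log 2 (real d) / real d powr \<eta>)
      + real d powr (- \<eta>) + real d powr (\<eta> - 1) < \<epsilon>"
    using assms(1) by (rule order_tendstoD)
  moreover have "\<forall>\<^sub>F d :: nat in sequentially. d \<ge> 1" by (rule eventually_ge_at_top)
  ultimately show ?thesis
  proof eventually_elim
    case (elim d)
    have d: "real d > 0" using elim by simp
    have "real (Suc i * d ^ i) = (real i + 1) * real d ^ i" by (simp add: algebra_simps)
    then have "log 2 (real (Suc i * d ^ i)) = log 2 (real i + 1) + real i * log 2 (real d)"
      using d log_mult[of 2 "real i + 1" "real d ^ i"] by (simp only: log_nat_power) simp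
    then have 1: "log 2 (real (Suc i * d ^ i)) / real d powr \<eta>
        = log 2 (real i + 1) / real d powr \<eta> + real i * (log 2 (real d) / real d powr \<eta>)"
      by (simp add: add_divide_distrib)
    have "real (nat \<lceil>real d powr (1 - 2 * \<eta>)\<rceil>) \<le> real d powr (1 - 2 * \<eta>) + 1"
      using of_int_ceiling_le_add_one[of "real d powr (1 - 2 * \<eta>)"] powr_ge_zero[of "real d" "1 - 2 * \<eta>"]
      by (simp add: le_nat_iff)
    then have "real (nat \<lceil>real d powr (1 - 2 * \<eta>)\<rceil>) * (real d powr \<eta> / real d)
      \<le> (real d powr (1 - 2 * \<eta>) + 1) * (real d powr \<eta> / real d)" by (intro mult_right_mono) auto
    also have "real d powr \<eta> / real d = real d powr (\<eta> - 1)" using d by (simp add: powr_diff)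
    also have "(real d powr (1 - 2 * \<eta>) + 1) * real d powr (\<eta> - 1) = real d powr (- \<eta>) + real d powr (\<eta> - 1)"
      by (simp add: distrib_right powr_add[symmetric])
    finally show ?case using 1 elim(1) d by (simp add: powr_diff)
  qed
qed

lemma small_cut_le_large_cut:
  fixes \<eta> \<alpha> :: real
  assumes "\<eta> > 0" "\<alpha> > 0"
  shows "\<forall>\<^sub>F d in sequentially. nat \<lceil>real d powr (1 - 2 * \<eta>)\<rceil> \<le> nat \<lceil>\<alpha> * real d\<rceil>"
proof -
  have "(\<lambda>d. real d powr (- 2 * \<eta>)) \<longlonglongrightarrow> 0" using assms by real_asymp
  then have "\<forall>\<^sub>F d in sequentially. real d powr (- 2 * \<eta>) < \<alpha>" using assms by (intro order_tendstoD)
  moreover have "\<forall>\<^sub>F d :: nat in sequentially. d \<ge> 1" by (rule eventually_ge_at_top)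
  ultimately show ?thesis
  proof eventually_elim
    case (elim d)
    then have "real d powr (1 - 2 * \<eta>) = real d powr (- 2 * \<eta>) * real d"
      by (simp add: powr_diff powr_minus field_simps)
    also have "\<dots> \<le> \<alpha> * real d" using elim by (intro mult_right_mono) auto
    finally show ?case by (intro nat_mono ceiling_mono)
  qed
qed


text \<open>One constant serves all families and all eigenvalues above the lower bound that holds
  for the ball, so the estimate covers both the competitor and the ball itself.\<close>

lemma compressed_eigenfunction_decay:
  fixes i :: nat and c :: real
  assumes i: "i \<ge> 1" and c: "c > 0" "hermite (Suc i) c = 0" "\<And>k. k \<le> i \<Longrightarrow> hermite k c > 0"
  defines "\<eta> \<equiv> 1 / (8 * (real i + 1))"
  obtains C where "C \<ge> 1" "\<forall>\<^sub>F d in sequentially. \<forall>F x \<theta>. F \<subseteq> Pow {1..d} \<and> compressed F \<and> {} \<in> F \<and>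
      card F = card (low_sets d i) \<and> c * sqrt (real d) * (1 - real i / real d) \<le> \<theta> \<and>
      (\<forall>u\<in>F. 0 \<le> x u \<and> nbsum F cube_adj x u = \<theta> * x u) \<longrightarrow>
      (\<forall>u\<in>F. x u \<le> C * x {} * (real d powr (\<eta> - 1 / 2)) ^ card u)"
proof -
  define \<alpha> where "\<alpha> = 1 - 1 / (4 * real i)"
  have \<alpha>: "\<alpha> > 0" "\<alpha> < 1" using i by (auto simp: \<alpha>_def field_simps)
  have \<eta>: "\<eta> > 0" "\<eta> \<le> 1 / 8" by (auto simp: \<eta>_def field_simps)
  obtain V c1 where V: "c1 < c" "\<And>a. a \<le> i \<Longrightarrow> V a > 0" "\<And>a. a > i \<Longrightarrow> V a = 0"
    "\<And>a. 1 \<le> a \<Longrightarrow> a \<le> i \<Longrightarrow> real a * V (a - 1) + V (Suc a) \<le> c1 * V a"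
    by (rule path_profile[OF i c]) (assumption | rule that)+
  obtain W c2 where W: "c2 < c" "\<And>p q. p + q \<le> i \<Longrightarrow> (p, q) \<noteq> (0, i) \<Longrightarrow> W p q > 0"
    "\<And>p q. \<not> (p + q \<le> i \<and> (p, q) \<noteq> (0, i)) \<Longrightarrow> W p q = 0"
    "\<And>p q. p + q \<le> i \<Longrightarrow> (p, q) \<noteq> (0, i) \<Longrightarrow>
       real p * W (p - 1) q + real q * W p (q - 1) + \<alpha> * W (Suc p) q + (1 - \<alpha>) * W p (Suc q) \<le> c2 * W p q"
    by (rule grid_profile[OF i c \<alpha>]) (assumption | rule that)+
  define c' where "c' = max c1 c2"
  have c': "c' < c" "c1 \<le> c'" "c2 \<le> c'" using V(1) W(1) by (auto simp: c'_def)
  define Y where "Y = {(p, q). p + q \<le> i \<and> (p, q) \<noteq> (0, i)}"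
  have finY: "finite Y" by (rule finite_subset[of _ "{..i} \<times> {..i}"]) (auto simp: Y_def)
  have V_pos: "V a > 0" if "a \<in> {..i}" for a using that V(2) by simp
  have W_pos: "W (fst y) (snd y) > 0" if "y \<in> Y" for y using that W(2) by (auto simp: Y_def)
  obtain m1 where m1: "m1 > 0" "\<And>a. a \<in> {..i} \<Longrightarrow> m1 \<le> V a"
    using finite_pos_lower_bound[of "{..i}" V, OF finite_atMost V_pos] by blast
  obtain m2 where m2: "m2 > 0" "\<And>y. y \<in> Y \<Longrightarrow> m2 \<le> W (fst y) (snd y)"
    using finite_pos_lower_bound[of Y "\<lambda>y. W (fst y) (snd y)", OF finY W_pos] by blast
  define m where "m = min m1 m2"
  have m: "m > 0" "\<And>a. a \<le> i \<Longrightarrow> m \<le> V a" "\<And>p q. p + q \<le> i \<Longrightarrow> (p, q) \<noteq> (0, i) \<Longrightarrow> m \<le> W p q"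
    using m1 m2 by (auto simp: m_def Y_def min.coboundedI1 min.coboundedI2)
  define B where "B = 1 + V 0 + (\<Sum>a\<le>i. V a) + (\<Sum>y\<in>Y. W (fst y) (snd y))"
  have Vs: "0 \<le> (\<Sum>a\<le>i. V a)" using V(2) by (intro sum_nonneg) (auto intro: less_imp_le)
  have Ws: "0 \<le> (\<Sum>y\<in>Y. W (fst y) (snd y))" using W(2) by (intro sum_nonneg) (auto intro: less_imp_le simp: Y_def)
  have V0: "V 0 > 0" using V(2) by simp
  have B: "B \<ge> 1" "B \<ge> V 0" using Vs Ws V0 by (auto simp: B_def)
  have V_le: "V a \<le> B" for a
  proof (cases "a \<le> i")
    case True
    then have "V a \<le> (\<Sum>a\<le>i. V a)" using V(2) by (intro member_le_sum) (auto intro: less_imp_le)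
    then show ?thesis using Ws V0 by (simp add: B_def)
  qed (use V(3) B in auto)
  have W_le: "W p q \<le> B" for p q
  proof (cases "(p, q) \<in> Y")
    case True
    then have "W (fst (p, q)) (snd (p, q)) \<le> (\<Sum>y\<in>Y. W (fst y) (snd y))"
      using W(2) finY by (intro member_le_sum) (auto intro: less_imp_le simp: Y_def)
    then show ?thesis using Vs V0 by (simp add: B_def)
  next
    case False
    then have "W p q = 0" using W(3)[of p q] by (simp add: Y_def)
    then show ?thesis using B by simp
  qed
  \<comment> \<open>Half of the gap between \<open>c'\<close> and \<open>c\<close>, rescaled by
    \<open>m / B\<close>: the room left for the error terms once \<theta> / sqrt d has passed the
    midpoint of the two.\<close>
  define \<epsilon> where "\<epsilon> = (c - c') / 2 * m / B"
  have \<epsilon>: "\<epsilon> > 0" using c' m B by (simp add: \<epsilon>_def)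
  have V_super: "real a * V (a - 1) + V (Suc a) \<le> c' * V a" if "1 \<le> a" "a \<le> i" for a
    using V(4)[OF that] mult_right_mono[OF c'(2) less_imp_le[OF V(2)[OF that(2)]]] by linarith
  have W_super: "real p * W (p - 1) q + real q * W p (q - 1) + \<alpha> * W (Suc p) q + (1 - \<alpha>) * W p (Suc q) \<le> c' * W p q"
    if "p + q \<le> i" "(p, q) \<noteq> (0, i)" for p q
    using W(4)[OF that] mult_right_mono[OF c'(3) less_imp_le[OF W(2)[OF that]]] by linarith
  have "(\<lambda>d. c * (1 - real i / real d)) \<longlonglongrightarrow> c * (1 - 0)" by (intro tendsto_intros)
  then have lim: "\<forall>\<^sub>F d in sequentially. c * (1 - real i / real d) > (c + c') / 2"
    by (rule order_tendstoD) (use c' in simp)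
  have "\<forall>\<^sub>F d in sequentially. \<forall>F x \<theta>. F \<subseteq> Pow {1..d} \<and> compressed F \<and> {} \<in> F \<and>
      card F = card (low_sets d i) \<and> c * sqrt (real d) * (1 - real i / real d) \<le> \<theta> \<and>
      (\<forall>u\<in>F. 0 \<le> x u \<and> nbsum F cube_adj x u = \<theta> * x u) \<longrightarrow>
      (\<forall>u\<in>F. x u \<le> B / V 0 * x {} * (real d powr (\<eta> - 1 / 2)) ^ card u)"
    using small_cut_large_enough[of i] large_cut_large_enough[OF i] error_terms_small[OF \<epsilon> i]
      small_cut_le_large_cut[OF \<eta>(1) \<alpha>(1)] lim eventually_ge_at_top[of "1 :: nat"]
    unfolding \<alpha>_def[symmetric] \<eta>_def[symmetric]
  proof eventually_elim
    case (elim d)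
    define t where "t = nat \<lceil>real d powr (1 - 2 * \<eta>)\<rceil>"
    define r where "r = nat \<lceil>\<alpha> * real d\<rceil>"
    define K where "K = log 2 (real (Suc i * d ^ i))"
    have d: "real d > 0" using elim by simp
    have e1: "Suc i * d ^ i < t choose Suc i" using elim by (simp add: t_def)
    have e2: "card (low_sets d i) < 2 * ((r - 1) choose i)" using elim by (simp add: r_def)
    have e3: "K / real d powr \<eta> + real t * real d powr \<eta> / real d < \<epsilon>" using elim by (simp only: t_def K_def)
    have e4: "t \<le> r" using elim by (simp add: t_def r_def)
    have e5: "c * (1 - real i / real d) > (c + c') / 2" using elim by simp
    have "\<alpha> * real d \<le> real d" using \<alpha> d by simp
    then have rd: "r \<le> d" unfolding r_def by linarith
    have "real d powr (1 - 2 * \<eta>) > 0" using d by simp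
    then have t1: "t \<ge> 1" unfolding t_def by linarith
    interpret decay_setup d t r i V W \<alpha> "real d powr \<eta>" "sqrt (real d)" c' B m
    proof
      show "1 \<le> real d powr \<eta>" using elim \<eta> by (simp add: ge_one_powr_ge_zero)
      have "real r \<le> \<alpha> * real d + 1" unfolding r_def using \<alpha> d of_int_ceiling_le_add_one[of "\<alpha> * real d"]
        by (simp add: le_nat_iff)
      \<comment> \<open>Rounding \<open>r\<close> up costs at most 1, which \<open>t \<ge> 1\<close>
        repays.\<close>
      then show "real (r - t) \<le> \<alpha> * real d" using t1 e4 by (simp add: of_nat_diff)
      have "\<alpha> * real d \<le> real r" unfolding r_def by linarith
      then show "real (d - r) \<le> (1 - \<alpha>) * real d" using rd by (simp add: of_nat_diff algebra_simps)
    qed (use e4 rd d V W m V_le W_le V_super W_super in auto)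
    show ?case
    proof (intro allI impI ballI)
      fix F x \<theta> u
      assume A: "F \<subseteq> Pow {1..d} \<and> compressed F \<and> {} \<in> F \<and>
        card F = card (low_sets d i) \<and> c * sqrt (real d) * (1 - real i / real d) \<le> \<theta> \<and>
        (\<forall>u\<in>F. 0 \<le> x u \<and> nbsum F cube_adj x u = \<theta> * x u)" and u: "u \<in> F"
      have F: "compressed F" "F \<subseteq> Pow {1..d}" "{} \<in> F" "card F = card (low_sets d i)" using A by auto
      have cF: "card F \<le> Suc i * d ^ i" using F(4) card_low_sets_le[of d i] elim by simp
      have feas: "feasible v" if v: "v \<in> F" for v
      proof -
        have fv: "finite v" using v F(2) finite_subset by blast
        have "card (v \<inter> {t<..d}) \<le> i" using cF e1 by (intro compressed_few_large[OF F(1,2) _ v]) simp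
        moreover have "v \<inter> {t<..d} = (v \<inter> L1) \<union> (v \<inter> L2)" using e4 rd by auto
        moreover have "card ((v \<inter> L1) \<union> (v \<inter> L2)) = card (v \<inter> L1) + card (v \<inter> L2)"
          using fv by (intro card_Un_disjoint) auto
        ultimately have "card (v \<inter> L1) + card (v \<inter> L2) \<le> i" by simp
        moreover have "v \<inter> S \<noteq> {} \<Longrightarrow> card (v \<inter> L2) \<noteq> i"
          using F(4) e2 by (intro compressed_no_heavy_pair[OF F(1,2) _ e4 v]) auto
        ultimately show ?thesis using v F(2) unfolding feasible_def by auto
      qed
      have Kle: "real (card v) \<le> K" if "v \<in> F" for v
        unfolding K_def using cF by (intro compressed_card_le_log[OF F(1,2) _ that] of_nat_mono)
      have "c * sqrt (real d) * (1 - real i / real d) / sqrt (real d) \<le> \<theta> / sqrt (real d)"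
        using A by (intro divide_right_mono) auto
      then have "c * (1 - real i / real d) \<le> \<theta> / sqrt (real d)" using d by simp
      with e5 have "(c + c') / 2 < \<theta> / sqrt (real d)" by (rule less_le_trans)
      moreover have "(c - c') / 2 \<le> y - c' \<and> c' \<le> y" if "(c + c') / 2 < y" for y
        using that c'(1) by (simp add: field_simps)
      ultimately have th: "(c - c') / 2 \<le> \<theta> / sqrt (real d) - c'" "c' \<le> \<theta> / sqrt (real d)" by blast+
      have "(K / real d powr \<eta> + real t * real d powr \<eta> / real d) * B < \<epsilon> * B"
        using e3 B by (intro mult_strict_right_mono) auto
      also have "\<dots> = (c - c') / 2 * m" using B by (simp add: \<epsilon>_def)
      also have "\<dots> \<le> (\<theta> / sqrt (real d) - c') * m" using th(1) m by (intro mult_right_mono) auto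
      finally have main: "(K / real d powr \<eta> + real t * real d powr \<eta> / real d) * B < (\<theta> / sqrt (real d) - c') * m" .
      have "x u \<le> B / V 0 * x {} * (real d powr \<eta> / sqrt (real d)) ^ card u"
        by (rule eigenfunction_decay[OF feas Kle F(3) _ _ main _ u]) (use A th(2) in auto)
      also have "real d powr \<eta> / sqrt (real d) = real d powr (\<eta> - 1 / 2)"
        using d by (simp add: powr_diff powr_half_sqrt)
      finally show "x u \<le> B / V 0 * x {} * (real d powr (\<eta> - 1 / 2)) ^ card u" .
    qed
  qed
  moreover have "B / V 0 \<ge> 1" using B V0 by simp
  ultimately show thesis by (rule that[rotated])
qed

section \<open>Comparison with the Hamming ball\<close>

text \<open>In \<open>nbsum H E y u\<close> the vertex \<open>u\<close> may lie outside
  \<open>H\<close>, so the form between two different families is a single double sum. On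
  \<open>F \<inter> H\<close> both eigenvalue equations apply; the two differences remain.\<close>

lemma eigenfunction_identity:
  assumes "finite F" "finite H" "symp E"
    and x: "\<And>u. u \<in> F \<Longrightarrow> nbsum F E x u = \<theta> * x u"
    and y: "\<And>u. u \<in> H \<Longrightarrow> nbsum H E y u = \<mu> * y u"
  shows "(\<theta> - \<mu>) * (\<Sum>u\<in>F \<inter> H. x u * y u) =
    (\<Sum>u\<in>F - H. x u * nbsum H E y u) - (\<Sum>v\<in>H - F. y v * nbsum F E x v)"
proof -
  have "(\<Sum>u\<in>F. x u * nbsum H E y u) = (\<Sum>u\<in>F. \<Sum>v\<in>H. if E u v then x u * y v else 0)"
    unfolding nbsum_def sum_distrib_left by (intro sum.cong) auto
  also have "\<dots> = (\<Sum>v\<in>H. \<Sum>u\<in>F. if E u v then x u * y v else 0)" by (rule sum.swap)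
  also have "\<dots> = (\<Sum>v\<in>H. y v * nbsum F E x v)"
    unfolding nbsum_def sum_distrib_left using assms(3) by (intro sum.cong) (auto dest: sympD)
  finally have "(\<Sum>u\<in>F. x u * nbsum H E y u) = (\<Sum>v\<in>H. y v * nbsum F E x v)" .
  moreover have "(\<Sum>u\<in>F. x u * nbsum H E y u) =
      (\<Sum>u\<in>F \<inter> H. x u * nbsum H E y u) + (\<Sum>u\<in>F - H. x u * nbsum H E y u)"
    using assms(1) by (subst sum.Int_Diff[of F _ H]) auto
  moreover have "(\<Sum>v\<in>H. y v * nbsum F E x v) =
      (\<Sum>v\<in>F \<inter> H. y v * nbsum F E x v) + (\<Sum>v\<in>H - F. y v * nbsum F E x v)"
    using assms(2) by (subst sum.Int_Diff[of H _ F]) (auto simp: Int_commute)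
  moreover have "(\<Sum>u\<in>F \<inter> H. x u * nbsum H E y u) = \<mu> * (\<Sum>u\<in>F \<inter> H. x u * y u)"
    unfolding sum_distrib_left using y by (intro sum.cong) auto
  moreover have "(\<Sum>v\<in>F \<inter> H. y v * nbsum F E x v) = \<theta> * (\<Sum>u\<in>F \<inter> H. x u * y u)"
    unfolding sum_distrib_left using x by (intro sum.cong) auto
  ultimately show ?thesis by (simp add: algebra_simps)
qed

lemma compressed_low_sets: "compressed (low_sets d i)"
proof -
  have "insert k (u - {l}) \<in> low_sets d i" if "u \<in> low_sets d i" "l \<in> u" "1 \<le> k" "k < l" "k \<notin> u" for u k l
  proof -
    have "finite u" using that finite_subset unfolding low_sets_def by blast
    then have "card (insert k (u - {l})) = card u" using that(2,5) card_Suc_Diff1[of u l] by simp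
    then show ?thesis using that by (auto simp: low_sets_def)
  qed
  moreover have "u - {j} \<in> low_sets d i" if "u \<in> low_sets d i" for u j
    using that card_Diff1_le[of u j] by (auto simp: low_sets_def)
  ultimately show ?thesis unfolding compressed_def by blast
qed

definition nonneg_eigenfunction :: "nat set set \<Rightarrow> (nat set \<Rightarrow> real) \<Rightarrow> real \<Rightarrow> bool" where
  "nonneg_eigenfunction F x \<theta> \<longleftrightarrow>
     (\<forall>u\<in>F. 0 \<le> x u \<and> nbsum F cube_adj x u = \<theta> * x u) \<and> (\<exists>u\<in>F. x u \<noteq> 0)"

text \<open>The Hermite weights satisfy the eigenvalue inequality pointwise in the direction
  opposite to a supersolution. Pairing with \<open>z\<close> transfers it to \<open>\<mu>\<close>,
  and the pairing is positive because the weights are strictly positive on the ball. The factor 1 -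
  i/d pays for having d - k instead of d upper neighbours.\<close>

lemma low_sets_eigenvalue_ge:
  assumes d: "d \<ge> 1" "d \<ge> i" and c: "c > 0" "hermite (Suc i) c = 0" "\<And>k. k \<le> i \<Longrightarrow> hermite k c > 0"
    and z: "nonneg_eigenfunction (low_sets d i) z \<mu>"
  shows "c * sqrt (real d) * (1 - real i / real d) \<le> \<mu>"
proof -
  let ?H = "low_sets d i"
  define s where "s = sqrt (real d)"
  have s: "s > 0" "real d = s * s" using d by (auto simp: s_def)
  define y where "y u = (if u \<in> ?H then hermite (card u) c / s ^ card u else 0)" for u :: "nat set"
  define \<theta> where "\<theta> = c * s * (1 - real i / real d)"
  have le: "\<theta> * y u \<le> nbsum ?H cube_adj y u" if u: "u \<in> ?H" for u
  proof -
    have ud: "u \<subseteq> {1..d}" "card u \<le> i" using u by (auto simp: low_sets_def)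
    have fin: "finite u" using ud finite_subset by blast
    define k where "k = card u"
    have k: "k \<le> i" using ud by (simp add: k_def)
    have "nbsum ?H cube_adj y u = nbsum (Pow {1..d}) cube_adj (\<lambda>v. if v \<in> ?H then y v else 0) u"
      by (intro nbsum_restrict) (auto simp: low_sets_def)
    also have "(\<lambda>v. if v \<in> ?H then y v else 0) = y" by (auto simp: y_def)
    also have "nbsum (Pow {1..d}) cube_adj y u = (\<Sum>j\<in>{1..d} \<inter> u. y (u - {j})) + (\<Sum>j\<in>{1..d} - u. y (insert j u))"
      using ud by (intro nbsum_cube) auto
    also have "(\<Sum>j\<in>{1..d} \<inter> u. y (u - {j})) = (\<Sum>j\<in>{1..d} \<inter> u. hermite (k - 1) c / s ^ (k - 1))"
      using ud fin by (intro sum.cong) (auto simp: y_def k_def low_sets_def)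
    also have "\<dots> = real k * (hermite (k - 1) c / s ^ (k - 1))" using ud by (simp add: inf_absorb2 k_def)
    also have "(\<Sum>j\<in>{1..d} - u. y (insert j u)) = (\<Sum>j\<in>{1..d} - u. hermite (Suc k) c / s ^ Suc k)"
    proof (intro sum.cong refl)
      fix j assume j: "j \<in> {1..d} - u"
      then have "card (insert j u) = Suc k" "insert j u \<subseteq> {1..d}" using ud fin by (auto simp: k_def)
      then show "y (insert j u) = hermite (Suc k) c / s ^ Suc k"
        using k c(2) by (cases "k = i") (auto simp: y_def low_sets_def)
    qed
    also have "\<dots> = real (d - k) * (hermite (Suc k) c / s ^ Suc k)"
      using ud fin by (simp add: card_Diff_subset k_def)
    finally have eq: "nbsum ?H cube_adj y u = real k * (hermite (k - 1) c / s ^ (k - 1)) + real (d - k) * (hermite (Suc k) c / s ^ Suc k)" .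
    have e1: "real k * (hermite (k - 1) c / s ^ (k - 1)) = s / s ^ k * (real k * hermite (k - 1) c)"
      using s by (cases k) auto
    have e2: "real (d - k) * (hermite (Suc k) c / s ^ Suc k) = s / s ^ k * ((1 - real k / real d) * hermite (Suc k) c)"
      using s d k by (simp add: of_nat_diff field_simps)
    have h: "0 \<le> hermite (k - 1) c" "0 \<le> hermite (Suc k) c"
      using k c(2) less_imp_le[OF c(3), of "k - 1"] less_imp_le[OF c(3), of "Suc k"]
      by (simp, cases "k = i") (simp_all del: hermite.simps)
    have r: "1 - real i / real d \<le> 1" "1 - real i / real d \<le> 1 - real k / real d"
      using d k by (auto intro!: divide_right_mono)
    have "(1 - real i / real d) * (c * hermite k c)
        = (1 - real i / real d) * (real k * hermite (k - 1) c) + (1 - real i / real d) * hermite (Suc k) c"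
      unfolding hermite_rec[symmetric] by (simp add: distrib_left)
    also have "\<dots> \<le> 1 * (real k * hermite (k - 1) c) + (1 - real k / real d) * hermite (Suc k) c"
      using r h by (intro add_mono mult_right_mono) auto
    finally have "s / s ^ k * ((1 - real i / real d) * (c * hermite k c))
      \<le> s / s ^ k * (real k * hermite (k - 1) c + (1 - real k / real d) * hermite (Suc k) c)"
      using s by (intro mult_left_mono) auto
    then show ?thesis unfolding eq e1 e2 distrib_left[symmetric]
      using u by (simp add: \<theta>_def y_def k_def mult_ac)
  qed
  have y0: "y u > 0" if "u \<in> ?H" for u using that c(3)[of "card u"] s by (auto simp: y_def low_sets_def)
  obtain w where w: "w \<in> ?H" "z w \<noteq> 0" using z by (auto simp: nonneg_eigenfunction_def)
  then have "z w > 0" using z by (auto simp: nonneg_eigenfunction_def less_le)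
  then have pos: "(\<Sum>u\<in>?H. z u * y u) > 0"
    using w(1) finite_low_sets[of d i] y0 z less_imp_le[OF y0]
    by (intro sum_pos2[of _ w]) (auto simp: nonneg_eigenfunction_def)
  have "\<theta> * (\<Sum>u\<in>?H. z u * y u) = (\<Sum>u\<in>?H. z u * (\<theta> * y u))"
    unfolding sum_distrib_left by (intro sum.cong) auto
  also have "\<dots> \<le> (\<Sum>u\<in>?H. z u * nbsum ?H cube_adj y u)"
    using le z by (intro sum_mono mult_left_mono) (auto simp: nonneg_eigenfunction_def)
  also have "\<dots> = (\<Sum>u\<in>?H. y u * nbsum ?H cube_adj z u)" by (rule nbsum_symmetric[OF symp_cube_adj])
  also have "\<dots> = \<mu> * (\<Sum>u\<in>?H. z u * y u)"
    unfolding sum_distrib_left using z by (intro sum.cong) (auto simp: nonneg_eigenfunction_def)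
  finally show ?thesis using pos by (simp add: \<theta>_def s_def)
qed

text \<open>Elements are deleted one at a time: the value at the smaller set is one summand of the
  neighbour sum, so it is at most \<theta> times the value at the larger one.\<close>

lemma eigenfunction_lower_bound:
  assumes F: "compressed F" "F \<subseteq> Pow {1..d}" and x: "\<And>u. u \<in> F \<Longrightarrow> 0 \<le> x u"
    "\<And>u. u \<in> F \<Longrightarrow> nbsum F cube_adj x u = \<theta> * x u"
    and \<theta>: "\<theta> \<le> b" "0 \<le> b" and u: "u \<in> F"
  shows "x {} \<le> b ^ card u * x u"
  using u
proof (induction "card u" arbitrary: u)
  case 0
  have "finite u" using 0 F(2) finite_subset by blast
  then have "u = {}" using 0 by simp
  then show ?case by simp
next
  case (Suc n)
  have finF: "finite F" using F(2) finite_subset by auto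
  have fin: "finite u" using Suc F(2) finite_subset by blast
  obtain j where j: "j \<in> u" using Suc by fastforce
  have uj: "u - {j} \<in> F" using F(1) Suc j unfolding compressed_def by blast
  have n: "n = card (u - {j})" using Suc(2) j fin by simp
  have "sym_diff u (u - {j}) = {j}" using j by auto
  then have adj: "cube_adj u (u - {j})" by (simp add: cube_adj_def)
  have "(if cube_adj u (u - {j}) then x (u - {j}) else 0) \<le> nbsum F cube_adj x u"
    unfolding nbsum_def using uj finF x(1) by (intro member_le_sum) auto
  then have "x (u - {j}) \<le> \<theta> * x u" using adj x(2)[OF Suc.prems] by simp
  also have "\<dots> \<le> b * x u" using \<theta> x(1)[OF Suc.prems] by (intro mult_right_mono) auto
  finally have "x (u - {j}) \<le> b * x u" .
  moreover have "x {} \<le> b ^ n * x (u - {j})" using Suc.hyps(1)[OF n uj] n by simp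
  ultimately have "x {} \<le> b ^ n * (b * x u)" using \<theta>(2) by (meson mult_left_mono order_trans zero_le_power)
  then show ?case unfolding Suc(2)[symmetric] by (simp add: mult_ac)
qed

lemma supersets_in_low_sets:
  assumes "d \<ge> 1" "v' \<subseteq> {1..d}"
  shows "card {v \<in> low_sets d i. v' \<subseteq> v} \<le> Suc i * d ^ (i - card v')"
proof -
  have fin: "finite v'" using assms finite_subset by blast
  have "card {v \<in> low_sets d i. v' \<subseteq> v} \<le> card (low_sets d (i - card v'))"
  proof (rule card_inj_on_le[of "\<lambda>v. v - v'"])
    show "inj_on (\<lambda>v. v - v') {v \<in> low_sets d i. v' \<subseteq> v}" by (rule inj_onI) auto
    show "(\<lambda>v. v - v') ` {v \<in> low_sets d i. v' \<subseteq> v} \<subseteq> low_sets d (i - card v')"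
      using fin by (auto simp: low_sets_def card_Diff_subset)
  qed (rule finite_low_sets)
  also have "\<dots> \<le> Suc (i - card v') * d ^ (i - card v')" using assms(1) by (rule card_low_sets_le)
  also have "\<dots> \<le> Suc i * d ^ (i - card v')" by (intro mult_right_mono) auto
  finally show ?thesis .
qed

text \<open>Each missing set is charged to a minimal missing subset \<open>v'\<close>, all of whose proper subsets
  carry weight; \<open>v'\<close> is charged at most \<open>O(d ^ (i - card v'))\<close> times.\<close>

lemma missing_sets_contribution:
  assumes F: "compressed F" "F \<subseteq> Pow {1..d}" "{} \<in> F"
    and x: "\<And>u. u \<in> F \<Longrightarrow> 0 \<le> x u" "\<And>u. u \<in> F \<Longrightarrow> nbsum F cube_adj x u = \<theta> * x u"
    and y: "\<And>u. u \<in> low_sets d i \<Longrightarrow> 0 \<le> y u"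
      "\<And>u. u \<in> low_sets d i \<Longrightarrow> nbsum (low_sets d i) cube_adj y u = \<mu> * y u"
    and b: "\<theta> \<le> b" "\<mu> \<le> b" "0 \<le> b" "real d \<le> b\<^sup>2" and d: "d \<ge> 1"
  shows "real (card (low_sets d i - F)) * (x {} * y {})
    \<le> real (Suc i) * b ^ (2 * i - 1) * (\<Sum>v\<in>low_sets d i - F. y v * nbsum F cube_adj x v)"
proof -
  let ?H = "low_sets d i" and ?M = "low_sets d i - F"
  define T where "T v = y v * nbsum F cube_adj x v" for v
  have finF: "finite F" using F(2) finite_subset by auto
  have HP: "?H \<subseteq> Pow {1..d}" by (auto simp: low_sets_def)
  have finH: "finite v" if "v \<in> ?H" for v using that HP finite_subset by blast
  have nb_nonneg: "0 \<le> nbsum F cube_adj x v" for v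
    unfolding nbsum_def using x(1) by (intro sum_nonneg) auto
  have Tn: "0 \<le> T v" if "v \<in> ?H" for v using y(1)[OF that] nb_nonneg by (simp add: T_def)
  have "\<exists>v'. v' \<subseteq> v \<and> v' \<notin> F \<and> (\<forall>j\<in>v'. v' - {j} \<in> F)" if v: "v \<in> ?M" for v
  proof -
    obtain v' where v': "v' \<subseteq> v \<and> v' \<notin> F" "\<And>w. w \<subseteq> v \<and> w \<notin> F \<Longrightarrow> card v' \<le> card w"
      using ex_has_least_nat[of "\<lambda>w. w \<subseteq> v \<and> w \<notin> F" v card] v by blast
    have fin: "finite v'" using v v'(1) finH finite_subset by blast
    have "v' - {j} \<in> F" if "j \<in> v'" for j
    proof (rule ccontr)
      assume "v' - {j} \<notin> F"
      then have "card v' \<le> card (v' - {j})" using v'(1) by (intro v'(2)) auto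
      moreover have "card (v' - {j}) < card v'" using fin that by (rule card_Diff1_less)
      ultimately show False by simp
    qed
    then show ?thesis using v' by blast
  qed
  then obtain p where p: "\<And>v. v \<in> ?M \<Longrightarrow> p v \<subseteq> v" "\<And>v. v \<in> ?M \<Longrightarrow> p v \<notin> F"
    "\<And>v j. v \<in> ?M \<Longrightarrow> j \<in> p v \<Longrightarrow> p v - {j} \<in> F" by metis
  have pM: "p v \<in> ?M" if v: "v \<in> ?M" for v
    using compressed_subset[OF compressed_low_sets[of d i], of v "p v"] v p(1,2)[OF v] finH by blast
  have charge: "real (card {v \<in> ?M. p v = v'}) * (x {} * y {}) \<le> real (Suc i) * b ^ (2 * i - 1) * T v'"
    if v': "v' \<in> p ` ?M" for v'
  proof -
    obtain v where v: "v \<in> ?M" "v' = p v" using v' by auto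
    have H: "v' \<in> ?H" "v' \<notin> F" using pM[OF v(1)] v by auto
    have del: "v' - {j} \<in> F" if "j \<in> v'" for j using p(3)[OF v(1)] v(2) that by simp
    have fin: "finite v'" using H finH by simp
    obtain j where j: "j \<in> v'" using H F(3) by (cases "v' = {}") auto
    define k where "k = card v'"
    have k: "1 \<le> k" "k \<le> i" using H j fin by (auto simp: k_def low_sets_def card_gt_0_iff Suc_le_eq)
    have "sym_diff v' (v' - {j}) = {j}" using j by auto
    then have adj: "cube_adj v' (v' - {j})" by (simp add: cube_adj_def)
    have "(if cube_adj v' (v' - {j}) then x (v' - {j}) else 0) \<le> nbsum F cube_adj x v'"
      unfolding nbsum_def using del[OF j] finF x(1) by (intro member_le_sum) auto
    then have nb: "x (v' - {j}) \<le> nbsum F cube_adj x v'" using adj by simp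
    have "x {} \<le> b ^ card (v' - {j}) * x (v' - {j})"
      by (rule eigenfunction_lower_bound[OF F(1,2) x b(1,3) del[OF j]])
    also have "card (v' - {j}) = k - 1" using j fin by (simp add: k_def)
    also have "b ^ (k - 1) * x (v' - {j}) \<le> b ^ (k - 1) * nbsum F cube_adj x v'"
      using nb b(3) by (intro mult_left_mono) auto
    finally have X: "x {} \<le> b ^ (k - 1) * nbsum F cube_adj x v'" .
    have Y: "y {} \<le> b ^ k * y v'" unfolding k_def
      by (rule eigenfunction_lower_bound[OF compressed_low_sets HP y b(2,3) H(1)])
    have xy0: "0 \<le> x {}" "0 \<le> y {}" using x(1)[OF F(3)] y(1)[of "{}"] by (auto simp: low_sets_def)
    \<comment> \<open>The factor for \<open>x\<close> has one power of \<open>b\<close> fewer: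
      \<open>v'\<close> is not in \<open>F\<close>, so its chain starts at \<open>v'\<close> with
      one element deleted.\<close>
    have XY: "x {} * y {} \<le> b ^ (k - 1 + k) * T v'"
    proof -
      have "x {} * y {} \<le> (b ^ (k - 1) * nbsum F cube_adj x v') * (b ^ k * y v')"
        using X Y xy0 b(3) nb_nonneg by (intro mult_mono) auto
      then show ?thesis by (simp add: T_def power_add mult_ac)
    qed
    have "{v \<in> ?M. p v = v'} \<subseteq> {v \<in> ?H. v' \<subseteq> v}" using p(1) by auto
    then have "card {v \<in> ?M. p v = v'} \<le> card {v \<in> ?H. v' \<subseteq> v}"
      using finite_low_sets by (intro card_mono) auto
    also have "\<dots> \<le> Suc i * d ^ (i - k)"
      unfolding k_def using d HP H by (intro supersets_in_low_sets) auto
    finally have "real (card {v \<in> ?M. p v = v'}) \<le> real (Suc i * d ^ (i - k))" by (rule of_nat_mono)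
    also have "\<dots> = real (Suc i) * real d ^ (i - k)" by (simp only: of_nat_mult of_nat_power)
    \<comment> \<open>Trading d for b^2 turns the number of charges and the decay into a common
      exponent 2 i - 1 that no longer depends on \<open>k\<close>.\<close>
    also have "\<dots> \<le> real (Suc i) * (b\<^sup>2) ^ (i - k)"
      using b(4) by (intro mult_left_mono power_mono) auto
    finally have C: "real (card {v \<in> ?M. p v = v'}) \<le> real (Suc i) * (b\<^sup>2) ^ (i - k)" .
    have "real (card {v \<in> ?M. p v = v'}) * (x {} * y {})
      \<le> (real (Suc i) * (b\<^sup>2) ^ (i - k)) * (b ^ (k - 1 + k) * T v')"
      by (rule mult_mono[OF C XY]) (use xy0 b(3) in auto)
    also have "\<dots> = real (Suc i) * b ^ (2 * (i - k) + (k - 1 + k)) * T v'"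
      by (simp add: power_add power_mult)
    also have "2 * (i - k) + (k - 1 + k) = 2 * i - 1" using k by simp
    finally show ?thesis .
  qed
  have "real (card ?M) * (x {} * y {}) = (\<Sum>v\<in>?M. x {} * y {})" by simp
  also have "\<dots> = (\<Sum>v'\<in>p ` ?M. \<Sum>v\<in>{v \<in> ?M. p v = v'}. x {} * y {})"
    using finite_low_sets by (intro sum.image_gen) auto
  also have "\<dots> \<le> (\<Sum>v'\<in>p ` ?M. real (Suc i) * b ^ (2 * i - 1) * T v')"
    using charge by (intro sum_mono) simp
  also have "\<dots> = real (Suc i) * b ^ (2 * i - 1) * (\<Sum>v'\<in>p ` ?M. T v')"
    by (simp add: sum_distrib_left)
  also have "\<dots> \<le> real (Suc i) * b ^ (2 * i - 1) * (\<Sum>v\<in>?M. T v)"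
    using pM Tn b(3) finite_low_sets by (intro mult_left_mono sum_mono2) auto
  finally show ?thesis by (simp add: T_def)
qed

text \<open>A set outside the ball has at least i + 1 elements, so it has neighbours in the ball
  only if it has exactly i + 1, and these are its i + 1 subsets on level i. The exponent i + 1 from
  \<open>x\<close> thus meets i from \<open>y\<close>.\<close>

lemma extra_sets_contribution:
  assumes F: "F \<subseteq> Pow {1..d}" and D: "D \<ge> 0"
    and x: "\<And>u. u \<in> F \<Longrightarrow> 0 \<le> x u" "\<And>u. u \<in> F \<Longrightarrow> x u \<le> a * D ^ card u"
    and y: "\<And>u. u \<in> low_sets d i \<Longrightarrow> 0 \<le> y u" "\<And>u. u \<in> low_sets d i \<Longrightarrow> y u \<le> a' * D ^ card u"
    and a: "0 \<le> a" "0 \<le> a'"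
  shows "(\<Sum>u\<in>F - low_sets d i. x u * nbsum (low_sets d i) cube_adj y u)
    \<le> real (card (F - low_sets d i)) * (real (Suc i) * a * a' * D ^ (2 * i + 1))"
proof -
  let ?H = "low_sets d i"
  define w where "w v = (if card v = i then a' * D ^ i else 0)" for v :: "nat set"
  have bound: "x u * nbsum ?H cube_adj y u \<le> real (Suc i) * a * a' * D ^ (2 * i + 1)" if u: "u \<in> F - ?H" for u
  proof -
    have ud: "u \<subseteq> {1..d}" using u F by auto
    have fin: "finite u" using ud finite_subset by blast
    have ci: "card u \<ge> Suc i" using u ud by (auto simp: low_sets_def)
    have "nbsum ?H cube_adj y u \<le> nbsum ?H cube_adj w u"
    proof (rule nbsum_mono)
      fix v assume v: "v \<in> ?H" "cube_adj u v"
      then have finv: "finite v" using finite_subset unfolding low_sets_def by blast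
      have "u \<subseteq> v \<union> sym_diff u v" by auto
      then have "card u \<le> card (v \<union> sym_diff u v)" using fin finv by (intro card_mono) auto
      also have "\<dots> \<le> card v + 1" using card_Un_le[of v "sym_diff u v"] v(2) by (simp add: cube_adj_def)
      finally have "card v = i" using ci v(1) by (simp add: low_sets_def)
      then show "y v \<le> w v" using y(2)[OF v(1)] by (simp add: w_def)
    qed
    also have "\<dots> \<le> (\<Sum>j\<in>{1..d} \<inter> u. w (u - {j})) + (\<Sum>j\<in>{1..d} - u. w (insert j u))"
      using ud a D by (intro nbsum_cube_le) (auto simp: w_def low_sets_def)
    also have "(\<Sum>j\<in>{1..d} - u. w (insert j u)) = 0"
      using ci fin by (intro sum.neutral) (auto simp: w_def)
    also have "(\<Sum>j\<in>{1..d} \<inter> u. w (u - {j})) = (\<Sum>j\<in>{1..d} \<inter> u. if card u = Suc i then a' * D ^ i else 0)"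
      using fin ci by (intro sum.cong) (auto simp: w_def)
    also have "\<dots> = (if card u = Suc i then real (Suc i) * (a' * D ^ i) else 0)"
      using ud by (simp add: inf_absorb2)
    finally have nb: "nbsum ?H cube_adj y u \<le> (if card u = Suc i then real (Suc i) * (a' * D ^ i) else 0)" by simp
    show ?thesis
    proof (cases "card u = Suc i")
      case True
      have "0 \<le> nbsum ?H cube_adj y u" unfolding nbsum_def using y(1) by (intro sum_nonneg) auto
      then have "x u * nbsum ?H cube_adj y u \<le> (a * D ^ Suc i) * (real (Suc i) * (a' * D ^ i))"
        using x(1)[of u] x(2)[of u] u nb True a D by (intro mult_mono) auto
      also have "\<dots> = real (Suc i) * a * a' * (D ^ Suc i * D ^ i)" by (simp only: mult_ac)
      also have "D ^ Suc i * D ^ i = D ^ (2 * i + 1)" by (simp only: power_add[symmetric]) (simp add: mult_2)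
      finally show ?thesis .
    next
      case False
      then have "x u * nbsum ?H cube_adj y u \<le> 0" using nb x(1)[of u] u by (simp add: mult_nonneg_nonpos)
      also have "0 \<le> real (Suc i) * a * a' * D ^ (2 * i + 1)" using a D by simp
      finally show ?thesis .
    qed
  qed
  then show ?thesis using sum_bounded_above[of "F - ?H" "\<lambda>u. x u * nbsum ?H cube_adj y u"] by simp
qed


text \<open>If the value at {} were 0, the decay bound would make \<open>x\<close> vanish. The
  equation at {}, which has at most \<open>d\<close> neighbours, then bounds \<theta>. For the decay
  rate in use the bound exceeds the order sqrt d only by a small power of d, which the final
  comparison can afford.\<close>

lemma decaying_eigenfunction:
  assumes F: "F \<subseteq> Pow {1..d}" "{} \<in> F"
    and x: "\<And>u. u \<in> F \<Longrightarrow> 0 \<le> x u" "\<And>u. u \<in> F \<Longrightarrow> nbsum F cube_adj x u = \<theta> * x u" "\<exists>u\<in>F. x u \<noteq> 0"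
    and decay: "\<And>u. u \<in> F \<Longrightarrow> x u \<le> C * x {} * D ^ card u" and CD: "C \<ge> 0" "D \<ge> 0"
  shows "x {} > 0" "\<theta> \<le> C * (real d * D)"
proof -
  show pos: "x {} > 0"
  proof (rule ccontr)
    assume "\<not> x {} > 0"
    then have "x {} = 0" using x(1)[OF F(2)] by simp
    then have "x u = 0" if "u \<in> F" for u using decay[OF that] x(1)[OF that] by simp
    then show False using x(3) by blast
  qed
  have "\<theta> * x {} = nbsum F cube_adj x {}" using x(2)[OF F(2)] by simp
  also have "\<dots> \<le> nbsum F cube_adj (\<lambda>_. C * x {} * D) {}"
    using decay by (intro nbsum_mono) (force simp: cube_adj_def)
  also have "\<dots> \<le> (\<Sum>j\<in>{1..d} \<inter> {}. C * x {} * D) + (\<Sum>j\<in>{1..d} - {}. C * x {} * D)"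
    using F CD pos by (intro nbsum_cube_le) auto
  also have "\<dots> = C * (real d * D) * x {}" by simp
  finally show "\<theta> \<le> C * (real d * D)" using pos by simp
qed

text \<open>The powers of d combine to the exponent 4 i \<eta> - 1, which the choice of \<eta> keeps
  below -1/2; the factor d^(-1/2) then absorbs all constants that depend on i and C.\<close>

lemma decay_beats_charge:
  fixes i :: nat and C :: real
  assumes "i \<ge> 1"
  defines "\<eta> \<equiv> 1 / (8 * (real i + 1))"
  shows "\<forall>\<^sub>F d in sequentially. real (Suc i) * C * C * (real d powr (\<eta> - 1 / 2)) ^ (2 * i + 1)
    * (real (Suc i) * (C * (real d * real d powr (\<eta> - 1 / 2))) ^ (2 * i - 1)) \<le> 1"
proof -
  define K where "K = real (Suc i) ^ 2 * C\<^sup>2 * C ^ (2 * i - 1)"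
  have "\<forall>\<^sub>F d in sequentially. real d powr (1 / 2) > \<bar>K\<bar>" by real_asymp
  moreover have "\<forall>\<^sub>F d :: nat in sequentially. d \<ge> 1" by (rule eventually_ge_at_top)
  ultimately show ?thesis
  proof eventually_elim
    case (elim d)
    define D where "D = real d powr (\<eta> - 1 / 2)"
    have d: "real d > 0" using elim by simp
    have "D ^ (2 * i + 1) * (real d * D) ^ (2 * i - 1) = real d powr ((\<eta> - 1 / 2) * real (2 * i + 1) + (\<eta> + 1 / 2) * real (2 * i - 1))"
    proof -
      have pw: "(real d powr e) ^ n = real d powr (e * real n)" for e n
        using d by (simp add: powr_powr[symmetric] powr_realpow)
      have dD: "real d * D = real d powr (\<eta> + 1 / 2)" using d powr_add[of "real d" 1 "\<eta> - 1 / 2"] by (simp add: D_def add.commute)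
      show ?thesis unfolding dD unfolding D_def pw powr_add[symmetric] ..
    qed
    also have "(\<eta> - 1 / 2) * real (2 * i + 1) + (\<eta> + 1 / 2) * real (2 * i - 1) = 4 * real i * \<eta> - 1"
      using assms(1) by (simp add: of_nat_diff algebra_simps)
    also have "real d powr (4 * real i * \<eta> - 1) \<le> real d powr (- 1 / 2)"
      using elim by (intro powr_mono) (auto simp: \<eta>_def field_simps)
    finally have le: "D ^ (2 * i + 1) * (real d * D) ^ (2 * i - 1) \<le> real d powr (- 1 / 2)" .
    have "real (Suc i) * C * C * D ^ (2 * i + 1) * (real (Suc i) * (C * (real d * D)) ^ (2 * i - 1))
        = K * (D ^ (2 * i + 1) * (real d * D) ^ (2 * i - 1))"
      unfolding power_mult_distrib[of C] by (simp only: K_def power2_eq_square mult_ac)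
    also have "\<dots> \<le> \<bar>K\<bar> * real d powr (- 1 / 2)"
      using le by (intro mult_mono) (auto simp: D_def)
    also have "\<dots> \<le> real d powr (1 / 2) * real d powr (- 1 / 2)" using elim by (intro mult_right_mono) auto
    also have "\<dots> = 1" using d by (simp add: powr_add[symmetric])
    finally show ?case unfolding D_def .
  qed
qed

lemma compressed_eigenvalue_le:
  fixes i :: nat
  assumes i: "i \<ge> 1"
  shows "\<forall>\<^sub>F d in sequentially. \<forall>F x y \<theta> \<mu>. F \<subseteq> Pow {1..d} \<and> compressed F \<and> {} \<in> F \<and>
      card F = card (low_sets d i) \<and> nonneg_eigenfunction F x \<theta> \<and> nonneg_eigenfunction (low_sets d i) y \<mu>
      \<longrightarrow> \<theta> \<le> \<mu>"
proof -
  define \<eta> where "\<eta> = 1 / (8 * (real i + 1))"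
  obtain c where c: "c > 0" "hermite (Suc i) c = 0" "\<And>k. k \<le> i \<Longrightarrow> hermite k c > 0"
    using hermite_largest_root[of i] i by auto
  obtain C where C: "C \<ge> 1" and decay: "\<forall>\<^sub>F d in sequentially. \<forall>F x \<theta>. F \<subseteq> Pow {1..d} \<and> compressed F \<and> {} \<in> F \<and>
      card F = card (low_sets d i) \<and> c * sqrt (real d) * (1 - real i / real d) \<le> \<theta> \<and>
      (\<forall>u\<in>F. 0 \<le> x u \<and> nbsum F cube_adj x u = \<theta> * x u) \<longrightarrow>
      (\<forall>u\<in>F. x u \<le> C * x {} * (real d powr (\<eta> - 1 / 2)) ^ card u)"
    using compressed_eigenfunction_decay[OF i c] unfolding \<eta>_def by blast
  show ?thesis
    using decay decay_beats_charge[OF i, of C, folded \<eta>_def] eventually_ge_at_top[of "max 1 i"]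
  proof eventually_elim
    case (elim d)
    define D where "D = real d powr (\<eta> - 1 / 2)"
    \<comment> \<open>The bound that \<open>decaying_eigenfunction\<close> yields, used for both
      eigenvalues.\<close>
    define b where "b = C * (real d * D)"
    let ?H = "low_sets d i"
    have d: "d \<ge> 1" "d \<ge> i" using elim by auto
    have D: "D \<ge> 0" by (simp add: D_def)
    have b0: "b \<ge> 0" using C D by (simp add: b_def)
    have small: "real (Suc i) * C * C * D ^ (2 * i + 1) * (real (Suc i) * b ^ (2 * i - 1)) \<le> 1"
      using elim by (simp only: D_def b_def)
    have "\<eta> > 0" by (simp add: \<eta>_def)
    then have "sqrt (real d) \<le> real d powr (\<eta> + 1 / 2)"
      using d by (subst powr_half_sqrt[symmetric]) (auto intro: powr_mono)
    also have "\<dots> = real d * D" using d powr_add[of "real d" 1 "\<eta> - 1 / 2"] by (simp add: D_def add.commute)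
    also have "\<dots> \<le> b" using mult_right_mono[OF C, of "real d * D"] D by (simp add: b_def)
    finally have bd: "real d \<le> b\<^sup>2" by (rule sqrt_le_D)
    show ?case
    proof (intro allI impI)
      fix F x y \<theta> \<mu>
      assume A: "F \<subseteq> Pow {1..d} \<and> compressed F \<and> {} \<in> F \<and> card F = card ?H \<and>
        nonneg_eigenfunction F x \<theta> \<and> nonneg_eigenfunction ?H y \<mu>"
      have F: "F \<subseteq> Pow {1..d}" "compressed F" "{} \<in> F" "card F = card ?H" using A by auto
      have x: "\<And>u. u \<in> F \<Longrightarrow> 0 \<le> x u" "\<And>u. u \<in> F \<Longrightarrow> nbsum F cube_adj x u = \<theta> * x u" "\<exists>u\<in>F. x u \<noteq> 0"
        using A by (auto simp: nonneg_eigenfunction_def)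
      have y: "\<And>u. u \<in> ?H \<Longrightarrow> 0 \<le> y u" "\<And>u. u \<in> ?H \<Longrightarrow> nbsum ?H cube_adj y u = \<mu> * y u" "\<exists>u\<in>?H. y u \<noteq> 0"
        using A by (auto simp: nonneg_eigenfunction_def)
      have H: "?H \<subseteq> Pow {1..d}" "compressed ?H" "{} \<in> ?H"
        using compressed_low_sets by (auto simp: low_sets_def)
      have finF: "finite F" using F(1) finite_subset by auto
      note finH = finite_low_sets[of d i]
      have \<mu>: "c * sqrt (real d) * (1 - real i / real d) \<le> \<mu>"
        by (rule low_sets_eigenvalue_ge[OF d c, where z = y]) (use A in simp_all)
      show "\<theta> \<le> \<mu>"
      proof (rule ccontr)
        assume "\<not> \<theta> \<le> \<mu>"
        then have lt: "\<mu> < \<theta>" by simp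
        \<comment> \<open>The assumption for contradiction is what makes the decay estimate
          available for \<open>F\<close>: \<theta> inherits the lower bound of \<mu>.\<close>
        have \<theta>: "c * sqrt (real d) * (1 - real i / real d) \<le> \<theta>" using \<mu> lt by linarith
        have dx: "x u \<le> C * x {} * D ^ card u" if "u \<in> F" for u
          by (rule elim(1)[rule_format, of F \<theta> x u, folded D_def]) (use F x \<theta> that in blast)+
        have dy: "y u \<le> C * y {} * D ^ card u" if "u \<in> ?H" for u
          by (rule elim(1)[rule_format, of ?H \<mu> y u, folded D_def]) (use H y \<mu> that in blast)+
        have C0: "C \<ge> 0" using C by simp
        note fx = decaying_eigenfunction[OF F(1,3) x dx C0 D]
        note fy = decaying_eigenfunction[OF H(1,3) y dy C0 D]
        define m where "m = real (card (F - ?H))"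
        have m': "m = real (card (?H - F))"
          using F(4) finF finH by (simp add: m_def card_Diff_subset_Int Int_commute)
        define q where "q = real (Suc i) * b ^ (2 * i - 1)"
        have q: "q > 0"
        proof -
          have "b > 0" using bd d b0 by (cases "b = 0") auto
          then show ?thesis by (simp add: q_def del: of_nat_Suc)
        qed
        define S2 where "S2 = (\<Sum>v\<in>?H - F. y v * nbsum F cube_adj x v)"
        have "(\<Sum>u\<in>F - ?H. x u * nbsum ?H cube_adj y u) \<le> m * (real (Suc i) * (C * x {}) * (C * y {}) * D ^ (2 * i + 1))"
          unfolding m_def by (rule extra_sets_contribution[OF F(1) D x(1) dx y(1) dy]) (use C0 fx(1) fy(1) in auto)
        also have "\<dots> = m * (x {} * y {}) * (real (Suc i) * C * C * D ^ (2 * i + 1))" by (simp only: mult_ac)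
        also have "\<dots> \<le> m * (x {} * y {}) * (1 / q)"
          using small q fx(1) fy(1) unfolding q_def[symmetric]
          by (intro mult_left_mono) (auto simp: m_def pos_le_divide_eq)
        also have "\<dots> \<le> S2"
        proof -
          have "m * (x {} * y {}) \<le> q * S2" unfolding m' q_def S2_def
            by (rule missing_sets_contribution[OF F(2,1,3) x(1,2) y(1,2) _ _ b0 bd d(1)])
              (use fx(2) fy(2) in \<open>auto simp: b_def\<close>)
          then show ?thesis using q by (simp add: pos_divide_le_eq mult.commute)
        qed
        finally have "(\<Sum>u\<in>F - ?H. x u * nbsum ?H cube_adj y u) \<le> S2" .
        moreover have "(\<theta> - \<mu>) * (\<Sum>u\<in>F \<inter> ?H. x u * y u) = (\<Sum>u\<in>F - ?H. x u * nbsum ?H cube_adj y u) - S2"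
          unfolding S2_def by (rule eigenfunction_identity[OF finF finH symp_cube_adj x(2) y(2)])
        ultimately have "(\<theta> - \<mu>) * (\<Sum>u\<in>F \<inter> ?H. x u * y u) \<le> 0" by simp
        moreover have "(\<Sum>u\<in>F \<inter> ?H. x u * y u) > 0"
          using finF F(3) H(3) fx(1) fy(1) x(1) y(1) by (intro sum_pos2[of _ "{}"]) auto
        ultimately show False using lt by (simp add: mult_le_0_iff)
      qed
    qed
  qed
qed

section \<open>Reduction of an arbitrary subgraph to a compressed family\<close>

lemma dominates_hypercube: "u \<rightarrow>\<^bsub>hypercube d\<^esub> v \<longleftrightarrow> u \<subseteq> {1..d} \<and> v \<subseteq> {1..d} \<and> cube_adj u v"
  by (simp add: hypercube_def cube_adj_def)

lemma nbsum_cong: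
  assumes "\<And>v. v \<in> V \<Longrightarrow> E u v = E' u v"
  shows "nbsum V E x u = nbsum V E' x u"
  unfolding nbsum_def using assms by (intro sum.cong) auto

text \<open>The compressed function need not be an eigenfunction; it only serves as a test function
  for the form on \<open>F\<close>, whose own maximiser is returned. Adding the cube edges that
  \<open>G\<close> lacks does not lower the form of a nonnegative function.\<close>

lemma subgraph_compression:
  assumes G: "graph G" "subgraph G (hypercube d)" "verts G \<noteq> {}"
  obtains F x \<theta> where "F \<subseteq> Pow {1..d}" "compressed F" "{} \<in> F" "card F = card (verts G)"
    "nonneg_eigenfunction F x \<theta>" "lambda1 G \<le> \<theta>"
proof -
  let ?P = "Pow {1..d} :: nat set set" and ?V = "verts G" and ?E = "\<lambda>u v. u \<rightarrow>\<^bsub>G\<^esub> v"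
  have VP: "?V \<subseteq> ?P" using G(2) by (auto simp: subgraph_def hypercube_def)
  have EG: "cube_adj u v" if "?E u v" for u v
    using arcs_ends_mono[OF G(2)] that dominates_hypercube[of u v d] by blast
  obtain g where g: "\<And>v. 0 \<le> g v" "\<exists>v\<in>?V. g v \<noteq> 0"
    "\<And>u. u \<in> ?V \<Longrightarrow> nbsum ?V ?E g u = lambda1 G * g u"
    by (rule lambda1_is_Rayleigh_max[OF G(1,3)]) (rule that; assumption)
  define x0 where "x0 v = (if v \<in> ?V then g v else 0)" for v
  have x0: "0 \<le> x0 v" "v \<notin> ?V \<Longrightarrow> x0 v = 0" for v using g(1) by (auto simp: x0_def)
  obtain F x where F: "F \<subseteq> ?P" "card F = card ?V" "compressed F"
    and x: "\<And>u. 0 \<le> x u" "\<And>u. u \<notin> F \<Longrightarrow> x u = 0"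
    "(\<Sum>u\<in>?P. (x u)\<^sup>2) = (\<Sum>u\<in>?P. (x0 u)\<^sup>2)"
    "(\<Sum>u\<in>?P. x0 u * nbsum ?P cube_adj x0 u) \<le> (\<Sum>u\<in>?P. x u * nbsum ?P cube_adj x u)"
    using compression[OF VP, of x0] x0 by blast
  have finF: "finite F" using F(1) finite_subset by auto
  have finV: "finite ?V" using VP finite_subset by auto
  have "F \<noteq> {}" using F(2) G(3) finV by auto
  then obtain u0 where u0: "u0 \<in> F" by blast
  have emp: "{} \<in> F" using compressed_subset[OF F(3) u0, of "{}"] F(1) u0 finite_subset by blast
  obtain y \<theta> where y: "\<And>v. 0 \<le> y v" "\<exists>v\<in>F. y v \<noteq> 0" "\<And>u. u \<in> F \<Longrightarrow> nbsum F cube_adj y u = \<theta> * y u"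
    "\<And>z. (\<Sum>u\<in>F. z u * nbsum F cube_adj z u) \<le> \<theta> * (\<Sum>v\<in>F. (z v)\<^sup>2)"
    by (rule Perron_nonneg_eigenfunction[OF finF \<open>F \<noteq> {}\<close> symp_cube_adj cube_adj_irrefl]) (rule that; assumption)
  have norm0: "(\<Sum>u\<in>?P. (x0 u)\<^sup>2) = (\<Sum>u\<in>?V. (g u)\<^sup>2)"
    using VP by (intro sum.mono_neutral_cong_right) (auto simp: x0_def)
  have norm: "(\<Sum>u\<in>?P. (x u)\<^sup>2) = (\<Sum>u\<in>F. (x u)\<^sup>2)"
    using F(1) x(2) by (intro sum.mono_neutral_right) auto
  have form: "(\<Sum>u\<in>?P. x u * nbsum ?P cube_adj x u) = (\<Sum>u\<in>F. x u * nbsum F cube_adj x u)"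
  proof -
    have "(\<lambda>v. if v \<in> F then x v else 0) = x" using x(2) by auto
    then have "nbsum F cube_adj x u = nbsum ?P cube_adj x u" for u
      using nbsum_restrict[of ?P F cube_adj x u] F(1) by simp
    then show ?thesis using F(1) x(2) by (simp add: sum.mono_neutral_right)
  qed
  have form0: "(\<Sum>u\<in>?V. g u * nbsum ?V ?E g u) \<le> (\<Sum>u\<in>?P. x0 u * nbsum ?P cube_adj x0 u)"
  proof -
    have "nbsum ?V ?E g u \<le> nbsum ?P cube_adj x0 u" for u
    proof -
      have "nbsum ?V ?E g u \<le> nbsum ?V cube_adj g u"
        unfolding nbsum_def using EG g(1) by (intro sum_mono) auto
      also have "\<dots> = nbsum ?P cube_adj x0 u"
        unfolding x0_def using VP by (intro nbsum_restrict) auto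
      finally show ?thesis .
    qed
    then have "(\<Sum>u\<in>?V. g u * nbsum ?V ?E g u) \<le> (\<Sum>u\<in>?V. g u * nbsum ?P cube_adj x0 u)"
      using g(1) by (intro sum_mono mult_left_mono)
    also have "\<dots> = (\<Sum>u\<in>?P. x0 u * nbsum ?P cube_adj x0 u)"
      using VP by (intro sum.mono_neutral_cong_left) (auto simp: x0_def)
    finally show ?thesis .
  qed
  have "lambda1 G * (\<Sum>u\<in>?V. (g u)\<^sup>2) = (\<Sum>u\<in>?V. g u * nbsum ?V ?E g u)"
    unfolding sum_distrib_left using g(3) by (intro sum.cong) (auto simp: power2_eq_square)
  also have "\<dots> \<le> \<theta> * (\<Sum>u\<in>?V. (g u)\<^sup>2)"
    using form0 x(4) form y(4)[of x] norm norm0 x(3) by simp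
  finally have "lambda1 G * (\<Sum>u\<in>?V. (g u)\<^sup>2) \<le> \<theta> * (\<Sum>u\<in>?V. (g u)\<^sup>2)" .
  moreover have "(\<Sum>u\<in>?V. (g u)\<^sup>2) > 0" using g(2) finV by (auto intro: sum_pos2)
  ultimately have "lambda1 G \<le> \<theta>" by simp
  moreover have "nonneg_eigenfunction F y \<theta>" using y by (auto simp: nonneg_eigenfunction_def)
  ultimately show thesis using that[of F y \<theta>] F emp by blast
qed

lemma hamming_ball_eigenfunction:
  "\<exists>y. nonneg_eigenfunction (low_sets d i) y (lambda1 (hamming_ball d i))"
proof -
  let ?B = "hamming_ball d i"
  interpret Q: graph "hypercube d" by (rule graph_hypercube)
  interpret B: digraph ?B by (rule Q.digraphI_induced[OF induced_subgraph_hamming_ball])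
  have verts: "verts ?B = low_sets d i" by (simp add: verts_hamming_ball low_sets_def)
  have dom: "u \<rightarrow>\<^bsub>?B\<^esub> v \<longleftrightarrow> u \<in> low_sets d i \<and> v \<in> low_sets d i \<and> cube_adj u v" for u v
    unfolding hamming_ball_def arcs_ends_conv
    by (auto simp: hypercube_def cube_adj_def low_sets_def image_iff)
  have "graph ?B"
  proof
    show "symmetric ?B" unfolding symmetric_def
      by (rule symI) (use dom symp_cube_adj in \<open>auto dest: sympD\<close>)
  qed
  have nb: "nbsum (low_sets d i) (\<lambda>u v. u \<rightarrow>\<^bsub>?B\<^esub> v) z u = nbsum (low_sets d i) cube_adj z u"
    if "u \<in> low_sets d i" for z u
    using dom that by (intro nbsum_cong) auto
  have ne: "verts ?B \<noteq> {}" unfolding verts by (auto simp: low_sets_def)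
  obtain y where y: "\<And>v. 0 \<le> y v" "\<exists>v\<in>verts ?B. y v \<noteq> 0"
    "\<And>u. u \<in> verts ?B \<Longrightarrow> nbsum (verts ?B) (\<lambda>u v. u \<rightarrow>\<^bsub>?B\<^esub> v) y u = lambda1 ?B * y u"
    by (rule lambda1_is_Rayleigh_max[OF \<open>graph ?B\<close> ne]) (rule that; assumption)
  then show ?thesis
    by (intro exI[of _ y]) (auto simp: nonneg_eigenfunction_def nb verts)
qed

text \<open>For i = 0 the root of h_1 is 0, so the argument based on c > 0 does not apply; both
  families consist of {} alone.\<close>

lemma compressed_eigenvalue_le_0:
  assumes F: "card F = card (low_sets d 0)" "{} \<in> F"
    and x: "nonneg_eigenfunction F x \<theta>" "nonneg_eigenfunction (low_sets d 0) y \<mu>"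
  shows "\<theta> \<le> \<mu>"
proof -
  have H: "low_sets d 0 = {{}}"
    unfolding low_sets_def by (auto dest: finite_subset[OF _ finite_atLeastAtMost])
  then have "card F = 1" using F(1) by simp
  then obtain a where "F = {a}" by (rule card_1_singletonE)
  then have "F = {{}}" using F(2) by simp
  then show ?thesis using x H by (auto simp: nonneg_eigenfunction_def nbsum_def cube_adj_irrefl)
qed

theorem theorem1p4:
  fixes i :: nat
  shows "\<exists>d0 :: nat. \<forall>d \<ge> d0. \<forall>G :: (nat set, nat set \<times> nat set) pre_digraph.
    graph G \<and> subgraph G (hypercube d) \<and>
    card (verts G) = card (verts (hamming_ball d i)) \<longrightarrow>
    lambda1 G \<le> lambda1 (hamming_ball d i)"
proof -
  let ?Q = "\<lambda>d. \<forall>F x y \<theta> \<mu>. F \<subseteq> Pow {1..d} \<and> compressed F \<and> {} \<in> F \<and>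
      card F = card (low_sets d i) \<and> nonneg_eigenfunction F x \<theta> \<and> nonneg_eigenfunction (low_sets d i) y \<mu>
      \<longrightarrow> \<theta> \<le> \<mu>"
  have "\<forall>\<^sub>F d in sequentially. ?Q d"
  proof (cases "i \<ge> 1")
    case True
    then show ?thesis by (rule compressed_eigenvalue_le)
  next
    case False
    then have "i = 0" by simp
    then show ?thesis using compressed_eigenvalue_le_0 by (intro always_eventually) blast
  qed
  then obtain d0 where d0: "\<forall>d\<ge>d0. ?Q d" unfolding eventually_sequentially ..
  show ?thesis
  proof (intro exI[of _ d0] allI impI)
    fix d and G :: "(nat set, nat set \<times> nat set) pre_digraph"
    assume d: "d \<ge> d0" and G: "graph G \<and> subgraph G (hypercube d) \<and>
      card (verts G) = card (verts (hamming_ball d i))"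
    have cG: "card (verts G) = card (low_sets d i)" using G by (simp add: verts_hamming_ball low_sets_def)
    have "{} \<in> low_sets d i" by (simp add: low_sets_def)
    then have "card (low_sets d i) \<noteq> 0" using finite_low_sets by auto
    then have ne: "verts G \<noteq> {}" using cG by auto
    have G': "graph G" "subgraph G (hypercube d)" using G by auto
    obtain F x \<theta> where F: "F \<subseteq> Pow {1..d}" "compressed F" "{} \<in> F" "card F = card (verts G)"
      "nonneg_eigenfunction F x \<theta>" "lambda1 G \<le> \<theta>"
      by (rule subgraph_compression[OF G' ne])
    obtain y where y: "nonneg_eigenfunction (low_sets d i) y (lambda1 (hamming_ball d i))"
      using hamming_ball_eigenfunction by blast
    have "\<theta> \<le> lambda1 (hamming_ball d i)"
      using d0[THEN spec, THEN mp, OF d, THEN spec[of _ F], THEN spec[of _ x], THEN spec[of _ y],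
          THEN spec[of _ \<theta>], THEN spec[of _ "lambda1 (hamming_ball d i)"]] F y cG by simp
    then show "lambda1 G \<le> lambda1 (hamming_ball d i)" using F(6) by simp
  qed
qed

end
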